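(* For every integer $N$ large enough that $K\ge 2$, let $K=K(N):=\lfloor \log_2 N - 2\log_2(\log N)\rfloor$ and define $$\Phi(N):=\frac{1}{K^2}\sum_{\substack{1\le h\le K-1\\ h\equiv 0 \bmod 2}}\ \sum_{1\le k_2\le K-h}\mathfrak{S}\bigl(d(k_2,h)\bigr),\qquad d(k_2,h):=2^{k_2}(2^h-1)-h .$$ Then $$\frac12\le \liminf_{N\to\infty}\Phi(N)\le \limsup_{N\to\infty}\Phi(N)\le \frac12\left(C_{\mathrm{Rom}}+e^{\gamma}\log 2\right),$$ where $\gamma$ is the Euler constant and $C_{\mathrm{Rom}}$ is the constant defined below.
   Context: $p$ always denotes a prime. For even $d\ge 2$, the singular series is $\mathfrak{S}(d):=2C_2\prod_{p\mid d,\ p>2}\left(1+\frac{1}{p-2}\right)$, where $C_2=\prod_{p\ge 3}\left(1-\frac{1}{(p-1)^2}\right)$ is the twin prime constant. (For $h$ even and $k_2\ge1$, $d(k_2,h)$ is even and positive.) Let $g$ be the multiplicative function supported on odd squarefree integers with $g(p)=\frac{1}{p-2}$ for odd primes $p$. For odd $\beta\ge1$, $\mathrm{ord}_\beta(2)$ denotes the multiplicative order of $2$ modulo $\beta$ (with $\mathrm{ord}_1(2)=1$). The Romanov-type constant is $C_{\mathrm{Rom}}:=\sum_{\beta\ge1,\ 2\nmid\beta}\frac{\mu^2(\beta)g(\beta)}{\mathrm{ord}_\beta(2)}$, a convergent series; $\mu$ is the Möbius function. *)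

theory Defs
  imports "HOL-Analysis.Analysis" "HOL-Number_Theory.Number_Theory" "HOL-Computational_Algebra.Squarefree"
begin

definition twin_prime_const :: real where
  "twin_prime_const =
     prodinf (\<lambda>p::nat. if prime p \<and> p \<ge> 3 then 1 - 1 / (real p - 1)\<^sup>2 else 1)"

text \<open>Only meaningful for even \<open>d \<ge> 2\<close>.\<close>

definition singular_series :: "int \<Rightarrow> real" where
  "singular_series d =
     2 * twin_prime_const *
     (\<Prod>p\<in>{p \<in> prime_factors d. p > 2}. 1 + 1 / (real_of_int p - 2))"

definition moebius :: "nat \<Rightarrow> int" where
  "moebius n = (if squarefree n then (- 1) ^ card (prime_factors n) else 0)"

definition gfun :: "nat \<Rightarrow> real" where
  "gfun n = (if odd n \<and> squarefree n then \<Prod>p\<in>prime_factors n. 1 / (real p - 2) else 0)"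

lemma gfun_one: "gfun 1 = 1"
  by (simp add: gfun_def)

lemma gfun_prime: "prime p \<Longrightarrow> odd p \<Longrightarrow> gfun p = 1 / (real p - 2)"
  by (simp add: gfun_def squarefree_prime prime_factorization_prime)

lemma gfun_mult:
  assumes "coprime m n"
  shows "gfun (m * n) = gfun m * gfun n"
proof (cases "m = 0 \<or> n = 0")
  case True
  then show ?thesis by (auto simp: gfun_def)
next
  case False
  have "prime_factors m \<inter> prime_factors n = {}"
    using assms by (auto simp: in_prime_factors_iff dest: coprime_common_divisor)
  then show ?thesis
    using False assms squarefree_mult_coprime[OF assms]
    by (auto simp: gfun_def prime_factors_product prod.union_disjoint dest: squarefree_multD)
qed

lemma ord_one_two: "ord (1::nat) 2 = 1"
  by (rule ord_1)

definition C_Rom :: real where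
  "C_Rom = (\<Sum>\<^sub>\<infinity>\<beta>\<in>{\<beta>::nat. odd \<beta>}.
     (real_of_int (moebius \<beta>))\<^sup>2 * gfun \<beta> / real (ord \<beta> 2))"

text \<open>The value for the finitely many \<open>N\<close> where the floor is negative is immaterial.\<close>

definition Kfun :: "nat \<Rightarrow> nat" where
  "Kfun N = nat \<lfloor>log 2 (real N) - 2 * log 2 (ln (real N))\<rfloor>"

definition dval :: "nat \<Rightarrow> nat \<Rightarrow> int" where
  "dval k h = 2 ^ k * (2 ^ h - 1) - int h"

definition Phi :: "nat \<Rightarrow> real" where
  "Phi N = 1 / (real (Kfun N))\<^sup>2 *
     (\<Sum>h\<in>{h \<in> {1..Kfun N - 1}. even h}. \<Sum>k\<in>{1..Kfun N - h}. singular_series (dval k h))"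

end

theory Submission
  imports Defs "HOL-Real_Asymp.Real_Asymp"
begin

text \<open>
  Expanding the product over primes, \<open>singular_series d\<close> is \<open>2 C\<^sub>2\<close> times the sum of \<open>g \<beta>\<close> over
  the odd squarefree \<open>\<beta>\<close> dividing \<open>d\<close>, and \<open>C\<^sub>2 (\<Sum>\<beta>. g \<beta> / \<beta>) = 1\<close>. Squarefree \<open>\<beta>\<close> are represented
  by their finite sets of prime factors.

  Upper bound. At most \<open>K / log 2 K\<close> primes above \<open>K\<close> divide \<open>d < 2 ^ K\<close>, and they contribute a factor
  \<open>1 + o(1)\<close>. A prime \<open>p\<close> dividing both \<open>d\<close> and \<open>2 ^ h - 1\<close> divides \<open>h\<close>; if \<open>\<beta>\<close> is coprime to
  \<open>2 ^ h - 1\<close>, the \<open>k\<close> with \<open>\<beta> dvd d\<close> lie in one class modulo \<open>ord \<beta> 2\<close>. Summing over \<open>k\<close> gives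
  \<open>C_Rom\<close>, and summing over \<open>h\<close> gives \<open>1 / C\<^sub>2\<close>, so the upper limit is at most \<open>C_Rom / 2\<close>.
  Convergence of \<open>C_Rom\<close> is Erdos's argument: the primes with \<open>ord p 2 < x\<close> number at most \<open>x\<^sup>2\<close>,
  so the \<open>g \<beta>\<close> with \<open>ord \<beta> 2 < x\<close> sum to \<open>O(x powr (2/3))\<close>, since primes above 3 are coprime to 6.

  Lower bound. For fixed \<open>\<beta>\<close> and \<open>k\<close>, exactly one in \<open>\<beta>\<close> of the even \<open>h\<close> satisfies \<open>\<beta> dvd d\<close>. Keeping
  only the primes up to \<open>y\<close> and letting first \<open>K\<close> and then \<open>y\<close> tend to infinity gives \<open>1 / 2\<close>.
\<close>

subsection \<open>Products over sets of odd primes\<close>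

text \<open>This is \<open>gfun\<close> at an odd prime, without the guard. The products that use it
  run over primes above 2, where it is positive.\<close>

definition weight :: "nat \<Rightarrow> real" where
  "weight p = 1 / (real p - 2)"

definition odd_primes_upto :: "nat \<Rightarrow> nat set" where
  "odd_primes_upto y = {p. prime p \<and> 2 < p \<and> p \<le> y}"

lemma finite_odd_primes_upto [simp]: "finite (odd_primes_upto y)"
  unfolding odd_primes_upto_def by (rule finite_subset[of _ "{..y}"]) auto

lemma weight_nonneg: "2 < p \<Longrightarrow> 0 \<le> weight p"
  by (simp add: weight_def)

lemma prod_one_plus_eq_sum_Pow:
  fixes f :: "'a \<Rightarrow> 'b::comm_semiring_1"
  assumes "finite P"
  shows "(\<Prod>p\<in>P. 1 + f p) = (\<Sum>A\<in>Pow P. prod f A)"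
  using prod_add[OF assms, of f "\<lambda>_. 1"] by (simp add: add.commute)

text \<open>The index set \<open>Pow P\<close> does not depend on \<open>Q\<close>, so a sum over a
  parameter of \<open>Q\<close> can later be moved inside.\<close>

lemma prod_one_plus_filter_eq_sum_Pow:
  fixes f :: "'a \<Rightarrow> 'b::comm_semiring_1"
  assumes "finite P"
  shows "(\<Prod>p\<in>{p \<in> P. Q p}. 1 + f p) = (\<Sum>A\<in>Pow P. if \<forall>p\<in>A. Q p then prod f A else 0)"
proof -
  have "Pow {p \<in> P. Q p} = {A \<in> Pow P. \<forall>p\<in>A. Q p}" by auto
  then show ?thesis
    using assms by (simp add: prod_one_plus_eq_sum_Pow sum.If_cases Int_def)
qed

lemma prime_factors_prod_primes:
  fixes A :: "nat set"
  assumes "finite A" "\<And>p. p \<in> A \<Longrightarrow> prime p"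
  shows "prime_factors (\<Prod>A) = A"
proof -
  have "0 \<notin> A" using assms(2) not_prime_0 by blast
  moreover have "prime_factors p = {p}" if "p \<in> A" for p
    using assms(2)[OF that] by (simp add: prime_factorization_prime)
  ultimately show ?thesis using assms(1) by (subst prime_factors_prod) auto
qed

lemma prod_primes_dvd_iff:
  fixes A :: "nat set"
  assumes "finite A" "\<And>p. p \<in> A \<Longrightarrow> prime p"
  shows "\<Prod>A dvd n \<longleftrightarrow> (\<forall>p\<in>A. p dvd n)"
  using assms
proof (induction A)
  case (insert p A)
  have "coprime p (\<Prod>A)"
    using insert by (intro prod_coprime_right) (metis insertCI primes_coprime)
  then show ?case
    using insert by (auto simp: divides_mult dest: dvd_mult_left dvd_mult_right)
qed auto

lemma prod_primes_dvd_int_iff: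
  assumes "finite A" "\<And>p::nat. p \<in> A \<Longrightarrow> prime p"
  shows "int (\<Prod>A) dvd d \<longleftrightarrow> (\<forall>p\<in>A. int p dvd d)"
  using prod_primes_dvd_iff[OF assms, of "nat \<bar>d\<bar>"] by (simp flip: int_dvd_int_iff)

lemma squarefree_prod_primes:
  fixes A :: "nat set"
  assumes "finite A" "\<And>p. p \<in> A \<Longrightarrow> prime p"
  shows "squarefree (\<Prod>A)"
  using assms
proof (induction A)
  case (insert p A)
  have "coprime p (\<Prod>A)"
    using insert by (intro prod_coprime_right) (metis insertCI primes_coprime)
  then show ?case
    using insert by (simp add: squarefree_mult_coprime squarefree_prime)
qed auto

lemma prod_odd_primes_odd:
  fixes A :: "nat set"
  assumes "finite A" "\<And>p. p \<in> A \<Longrightarrow> prime p \<and> 2 < p"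
  shows "odd (\<Prod>A)"
  using assms by (auto simp: even_prod_iff dest: prime_odd_nat)

lemma gfun_prod_primes:
  assumes "finite A" "\<And>p. p \<in> A \<Longrightarrow> prime p \<and> 2 < p"
  shows "gfun (\<Prod>A) = prod weight A"
  using assms squarefree_prod_primes[of A] prod_odd_primes_odd[of A] prime_factors_prod_primes[of A]
  by (simp add: gfun_def weight_def)

lemma singular_series_eq:
  assumes "d \<noteq> 0"
  shows "singular_series d =
    2 * twin_prime_const * (\<Prod>p\<in>{p. prime p \<and> 2 < p \<and> int p dvd d}. 1 + weight p)"
proof -
  have "{p \<in> prime_factors d. p > 2} = int ` {p. prime p \<and> 2 < p \<and> int p dvd d}"
  proof (intro equalityI subsetI)
    fix p assume "p \<in> {p \<in> prime_factors d. p > 2}"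
    then show "p \<in> int ` {p. prime p \<and> 2 < p \<and> int p dvd d}"
      by (intro image_eqI[of _ _ "nat p"]) auto
  qed (use assms in \<open>auto simp: in_prime_factors_iff\<close>)
  then show ?thesis
    unfolding singular_series_def weight_def by (simp add: prod.reindex)
qed

lemma finite_prime_divisors:
  assumes "d \<noteq> (0::int)"
  shows "finite {p::nat. prime p \<and> 2 < p \<and> int p dvd d}"
proof (rule finite_subset)
  show "{p::nat. prime p \<and> 2 < p \<and> int p dvd d} \<subseteq> {..nat \<bar>d\<bar>}"
  proof clarsimp
    fix p :: nat assume "int p dvd d"
    then have "int p \<le> \<bar>d\<bar>" using assms zdvd_imp_le[of "int p" "\<bar>d\<bar>"] by simp
    then show "p \<le> nat \<bar>d\<bar>" by linarith
  qed
qed simp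

section \<open>Growth of products of \<open>1 + weight p\<close>\<close>

lemma power_card_le_dvd:
  fixes b :: nat
  assumes "finite Q" "\<And>q. q \<in> Q \<Longrightarrow> prime q \<and> b \<le> q \<and> q dvd n" "n > 0"
  shows "b ^ card Q \<le> n"
proof -
  have "b ^ card Q \<le> \<Prod>Q"
    using assms(2) prod_mono[of Q "\<lambda>_. b" "\<lambda>q. q"] by simp
  also have "\<dots> \<le> n"
    using assms by (intro dvd_imp_le) (auto simp: prod_primes_dvd_iff)
  finally show ?thesis .
qed

text \<open>Induction in steps of 6: of six consecutive numbers at most two are primes above 3, and
  the bound \<open>6 j - 2\<close> is chosen so that Bernoulli's inequality makes the step telescope.\<close>

lemma prod_upto_cube_bound_aux:
  assumes "j \<ge> 1"
  shows "(\<Prod>p\<in>odd_primes_upto (6 * j + 1). 1 + weight p) ^ 3 \<le> 9 * (6 * real j - 2)"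
  using assms
proof (induction j rule: nat_induct_at_least)
  \<comment> \<open>The product is 2 * 4/3 * 6/5 = 3.2, with cube 32.768; 9 is the least integer
    factor for which \<open>9 * 4\<close> exceeds it.\<close>
  case base
  have "odd_primes_upto 7 = {3, 5, 7}"
  proof -
    have np: "\<not> prime (4::nat)" "\<not> prime (6::nat)" "prime (3::nat)" "prime (5::nat)" "prime (7::nat)"
      by simp_all
    have "p \<in> {3, 5, 7}" if "p \<in> odd_primes_upto 7" for p
    proof -
      have "p = 3 \<or> p = 4 \<or> p = 5 \<or> p = 6 \<or> p = 7"
        using that unfolding odd_primes_upto_def by (elim CollectE conjE) arith
      with np that show ?thesis by (auto simp: odd_primes_upto_def)
    qed
    moreover have "{3, 5, 7} \<subseteq> odd_primes_upto 7"
      using np by (simp add: odd_primes_upto_def)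
    ultimately show ?thesis by blast
  qed
  then show ?case by (simp add: weight_def power3_eq_cube)
next
  case (Suc j)
  let ?W = "\<lambda>j. \<Prod>p\<in>odd_primes_upto (6 * j + 1). 1 + weight p"
  let ?N = "{6 * j + 5, 6 * j + 7}"
  let ?x = "1 / (6 * real j + 3)"
  have sub: "odd_primes_upto (6 * Suc j + 1) \<subseteq> odd_primes_upto (6 * j + 1) \<union> ?N"
  proof
    fix p assume p: "p \<in> odd_primes_upto (6 * Suc j + 1)"
    then have pp: "prime p" "2 < p" "p \<le> 6 * j + 7" by (auto simp: odd_primes_upto_def)
    have "\<not> 2 dvd p" using pp prime_odd_nat by auto
    moreover have "p \<noteq> 6 * j + 3"
    proof
      assume "p = 6 * j + 3"
      then have "3 dvd p" by presburger
      then have "p = 3" using pp primes_dvd_imp_eq[of 3 p] by simp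
      with \<open>p = 6 * j + 3\<close> Suc.hyps show False by simp
    qed
    ultimately have "p \<le> 6 * j + 1 \<or> p = 6 * j + 5 \<or> p = 6 * j + 7"
      using pp by presburger
    then show "p \<in> odd_primes_upto (6 * j + 1) \<union> ?N"
      using pp by (auto simp: odd_primes_upto_def)
  qed
  have "?W (Suc j) \<le> (\<Prod>p\<in>odd_primes_upto (6 * j + 1) \<union> ?N. 1 + weight p)"
    by (rule prod_mono2) (use sub in \<open>auto simp: odd_primes_upto_def weight_def\<close>)
  also have "\<dots> = ?W j * (\<Prod>p\<in>?N. 1 + weight p)"
    by (rule prod.union_disjoint) (auto simp: odd_primes_upto_def)
  finally have W1: "?W (Suc j) \<le> ?W j * (\<Prod>p\<in>?N. 1 + weight p)" .
  have "(\<Prod>p\<in>?N. 1 + weight p) = (1 + weight (6 * j + 5)) * (1 + weight (6 * j + 7))"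
    by simp
  \<comment> \<open>The smaller candidate \<open>6 * j + 5\<close> has weight exactly
    \<open>?x\<close>, the other one less.\<close>
  also have "\<dots> \<le> (1 + ?x) * (1 + ?x)"
    by (intro mult_mono) (auto simp: weight_def frac_le)
  finally have F: "(\<Prod>p\<in>?N. 1 + weight p) \<le> (1 + ?x)\<^sup>2"
    by (simp only: power2_eq_square)
  have Wn: "0 \<le> ?W i" for i
    by (intro prod_nonneg) (auto simp: odd_primes_upto_def weight_def)
  have W: "?W (Suc j) \<le> ?W j * (1 + ?x)\<^sup>2"
    by (rule order_trans[OF W1 mult_left_mono[OF F Wn]])
  \<comment> \<open>Two new factors, cubed, give the exponent 6. Bernoulli's bound is the ratio of
    the values of \<open>6 * j - 2\<close> at \<open>j\<close> and \<open>Suc j\<close>.\<close>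
  have "(1 - 1 / (6 * real j + 4)) ^ 6 \<ge> 1 + real 6 * (- (1 / (6 * real j + 4)))"
    using Bernoulli_inequality[of "- (1 / (6 * real j + 4))" 6] by (simp add: field_simps)
  also have "1 + real 6 * (- (1 / (6 * real j + 4))) = (6 * real j - 2) / (6 * real j + 4)"
    by (simp add: field_simps)
  also have "1 - 1 / (6 * real j + 4) = 1 / (1 + ?x)"
    by (simp add: field_simps)
  finally have key0: "(6 * real j - 2) / (6 * real j + 4) \<le> 1 / (1 + ?x) ^ 6"
    by (simp add: power_one_over)
  have cross: "a * c \<le> b" if "a / b \<le> 1 / c" "0 < b" "0 < c" for a b c :: real
    using that by (simp add: field_simps)
  have key: "(6 * real j - 2) * (1 + ?x) ^ 6 \<le> 6 * real j + 4"
  proof (rule cross[OF key0])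
    show "0 < (1 + ?x) ^ 6" by (intro zero_less_power add_pos_nonneg) auto
  qed simp
  have "?W (Suc j) ^ 3 \<le> (?W j * (1 + ?x)\<^sup>2) ^ 3"
    by (rule power_mono[OF W Wn])
  also have "\<dots> = ?W j ^ 3 * (1 + ?x) ^ 6"
    by (simp add: power_mult_distrib flip: power_mult)
  also have "\<dots> \<le> 9 * (6 * real j - 2) * (1 + ?x) ^ 6"
    using Suc.IH by (intro mult_right_mono) auto
  also have "\<dots> = 9 * ((6 * real j - 2) * (1 + ?x) ^ 6)"
    by (rule mult.assoc)
  also have "\<dots> \<le> 9 * (6 * real j + 4)"
    by (rule mult_left_mono[OF key]) simp
  also have "\<dots> = 9 * (6 * real (Suc j) - 2)"
    by simp
  finally show ?case .
qed


lemma prod_upto_nonneg: "0 \<le> (\<Prod>p\<in>odd_primes_upto y. 1 + weight p)"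
  by (intro prod_nonneg) (auto simp: odd_primes_upto_def weight_def)

text \<open>Monotonicity in \<open>y\<close> carries the bound over from \<open>6 * j + 1\<close>.
  The product is O(y powr (1/3)); an exponent below 1/2 is what the Romanov series needs, where
  \<open>y\<close> is the square of the bound on the order.\<close>

lemma prod_upto_cube_bound:
  assumes "y \<ge> 1"
  shows "(\<Prod>p\<in>odd_primes_upto y. 1 + weight p) ^ 3 \<le> 90 * real y"
proof -
  define j where "j = y div 6 + 1"
  have j: "y \<le> 6 * j + 1" "j \<ge> 1" "6 * j \<le> y + 6"
    unfolding j_def by simp_all
  have "(\<Prod>p\<in>odd_primes_upto y. 1 + weight p) \<le> (\<Prod>p\<in>odd_primes_upto (6 * j + 1). 1 + weight p)"
    by (rule prod_mono2) (use j in \<open>auto simp: odd_primes_upto_def weight_def\<close>)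
  then have "(\<Prod>p\<in>odd_primes_upto y. 1 + weight p) ^ 3 \<le> (\<Prod>p\<in>odd_primes_upto (6 * j + 1). 1 + weight p) ^ 3"
    by (rule power_mono[OF _ prod_upto_nonneg])
  also have "\<dots> \<le> 9 * (6 * real j - 2)"
    by (rule prod_upto_cube_bound_aux[OF j(2)])
  also have "\<dots> \<le> 90 * real y"
    using assms of_nat_mono[OF j(3), where ?'a = real] by simp
  finally show ?thesis .
qed

lemma prod_large_primes_bound:
  assumes "\<And>p. p \<in> Q \<Longrightarrow> y < p" "y \<ge> 2"
  shows "(\<Prod>p\<in>Q. 1 + weight p) \<le> exp (real (card Q) / (real y - 1))"
proof -
  have "(\<Prod>p\<in>Q. 1 + weight p) \<le> (\<Prod>p\<in>Q. exp (1 / (real y - 1)))"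
  proof (rule prod_mono, intro conjI)
    fix p assume "p \<in> Q"
    then have p: "y < p" by (rule assms)
    then show "0 \<le> 1 + weight p" using assms(2) by (simp add: weight_def)
    have "weight p \<le> 1 / (real y - 1)"
      unfolding weight_def using p assms(2) by (intro divide_left_mono) auto
    then show "1 + weight p \<le> exp (1 / (real y - 1))"
      using exp_ge_add_one_self[of "1 / (real y - 1)"] by linarith
  qed
  then show ?thesis by (simp flip: exp_of_nat_mult)
qed

text \<open>Primes up to \<open>y\<close> are enlarged to all odd primes up to \<open>y\<close>;
  each larger one costs at most exp (1 / (y - 1)). This is efficient when \<open>card Q\<close> is
  O(y).\<close>

lemma prod_primes_bound:
  assumes "finite Q" "\<And>p. p \<in> Q \<Longrightarrow> prime p \<and> 2 < p" "y \<ge> 2"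
  shows "(\<Prod>p\<in>Q. 1 + weight p) \<le>
    (\<Prod>p\<in>odd_primes_upto y. 1 + weight p) * exp (real (card Q) / (real y - 1))"
proof -
  let ?S = "{p \<in> Q. p \<le> y}" and ?L = "{p \<in> Q. y < p}"
  have "(\<Prod>p\<in>Q. 1 + weight p) = (\<Prod>p\<in>?S. 1 + weight p) * (\<Prod>p\<in>?L. 1 + weight p)"
    using assms(1) by (subst prod.union_disjoint[symmetric]) (auto intro!: prod.cong)
  also have "\<dots> \<le> (\<Prod>p\<in>odd_primes_upto y. 1 + weight p) * exp (real (card Q) / (real y - 1))"
  proof (rule mult_mono)
    show "(\<Prod>p\<in>?S. 1 + weight p) \<le> (\<Prod>p\<in>odd_primes_upto y. 1 + weight p)"
      by (rule prod_mono2) (use assms(2) in \<open>auto simp: odd_primes_upto_def weight_def dest!: assms(2)\<close>)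
    have "(\<Prod>p\<in>?L. 1 + weight p) \<le> exp (real (card ?L) / (real y - 1))"
      by (rule prod_large_primes_bound) (use assms in auto)
    also have "\<dots> \<le> exp (real (card Q) / (real y - 1))"
      using assms card_mono[of Q ?L] by (simp add: divide_right_mono)
    finally show "(\<Prod>p\<in>?L. 1 + weight p) \<le> exp (real (card Q) / (real y - 1))" .
    show "0 \<le> (\<Prod>p\<in>?L. 1 + weight p)"
      by (intro prod_nonneg) (auto simp: weight_def dest!: assms(2))
  qed (rule prod_upto_nonneg)
  finally show ?thesis .
qed

subsection \<open>The twin prime constant and the Romanov constant\<close>

text \<open>The local factors are inverse to each other because (p - 1)^2 = p (p - 2) + 1.\<close>

lemma prod_weight_over_mult_twin:
  "(\<Prod>p\<in>odd_primes_upto y. 1 - 1 / (real p - 1)\<^sup>2) *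
   (\<Prod>p\<in>odd_primes_upto y. 1 + weight p / real p) = 1"
proof -
  have "(1 - 1 / (real p - 1)\<^sup>2) * (1 + weight p / real p) = 1" if "p \<in> odd_primes_upto y" for p
  proof -
    define x where "x = real p - 2"
    have x: "x > 0" and p: "real p = x + 2" using that by (auto simp: x_def odd_primes_upto_def)
    have sq: "(x + 1)\<^sup>2 = x * (x + 2) + 1"
      by (simp add: algebra_simps power2_eq_square)
    have nz: "x * (x + 2) \<noteq> 0" "(x + 1)\<^sup>2 \<noteq> 0"
      using x by simp_all
    have "1 - 1 / (x + 1)\<^sup>2 = x * (x + 2) / (x + 1)\<^sup>2"
      using nz(2) sq by (simp only: eq_divide_eq left_diff_distrib) simp
    moreover have "1 + 1 / x / (x + 2) = (x + 1)\<^sup>2 / (x * (x + 2))"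
      unfolding sq using nz(1) by (simp only: eq_divide_eq distrib_right divide_divide_eq_left) simp
    moreover have "x * (x + 2) / (x + 1)\<^sup>2 * ((x + 1)\<^sup>2 / (x * (x + 2))) = 1"
      using nz by simp
    moreover have "real p - 1 = x + 1" using p by simp
    ultimately show ?thesis
      unfolding weight_def x_def[symmetric] by (simp only: p)
  qed
  then show ?thesis by (simp flip: prod.distrib)
qed

lemma twin_prime_const_limit:
  "(\<lambda>y. \<Prod>p\<in>odd_primes_upto y. 1 - 1 / (real p - 1)\<^sup>2) \<longlonglongrightarrow> twin_prime_const"
  and twin_prime_const_nonzero: "twin_prime_const \<noteq> 0"
proof -
  let ?t = "\<lambda>p::nat. if prime p \<and> p \<ge> 3 then 1 - 1 / (real p - 1)\<^sup>2 else 1"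
  have "summable (\<lambda>n. 1 / (real n)\<^sup>2)"
    using inverse_power_summable[of 2, where ?'a = real] by (simp add: inverse_eq_divide)
  then have "summable (\<lambda>n. 1 / (real (Suc n) - 1)\<^sup>2)" by simp
  then have sm: "summable (\<lambda>n. 1 / (real n - 1)\<^sup>2)"
    by (subst (asm) summable_Suc_iff)
  have "summable (\<lambda>n. norm (?t n - 1))"
    by (rule summable_comparison_test'[OF sm, of 0]) auto
  then have conv: "convergent_prod ?t"
    by (intro abs_convergent_prod_imp_convergent_prod summable_imp_abs_convergent_prod)
  \<comment> \<open>A convergent product vanishes only if a factor does; the guard
    \<open>p \<ge> 3\<close> excludes the zero factor that p = 2 would give.\<close>
  have nz: "?t n \<noteq> 0" for n
  proof (cases "n \<ge> 3")
    case True
    then have "(real n - 1)\<^sup>2 \<ge> 2\<^sup>2" by (intro power_mono) auto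
    then show ?thesis by auto
  qed simp
  show "twin_prime_const \<noteq> 0"
    unfolding twin_prime_const_def by (rule prodinf_nonzero[OF conv nz])
  have "(\<Prod>p\<le>y. ?t p) = (\<Prod>p\<in>odd_primes_upto y. 1 - 1 / (real p - 1)\<^sup>2)" for y
    by (rule prod.mono_neutral_cong_right) (auto simp: odd_primes_upto_def)
  then show "(\<lambda>y. \<Prod>p\<in>odd_primes_upto y. 1 - 1 / (real p - 1)\<^sup>2) \<longlonglongrightarrow> twin_prime_const"
    using convergent_prod_LIMSEQ[OF conv] by (simp add: twin_prime_const_def)
qed

lemma twin_factor_bounds:
  assumes "p > (2::nat)"
  shows "0 \<le> 1 - 1 / (real p - 1)\<^sup>2" "1 - 1 / (real p - 1)\<^sup>2 \<le> 1"
proof -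
  have "(real p - 1)\<^sup>2 \<ge> 1" using assms by simp
  then show "0 \<le> 1 - 1 / (real p - 1)\<^sup>2" "1 - 1 / (real p - 1)\<^sup>2 \<le> 1"
    by (simp_all add: divide_le_eq_1)
qed

lemma twin_prime_const_nonneg: "0 \<le> twin_prime_const"
  by (rule LIMSEQ_le_const[OF twin_prime_const_limit])
    (auto intro!: prod_nonneg exI[of _ 0] twin_factor_bounds simp: odd_primes_upto_def)

text \<open>All factors lie in [0, 1], so the partial products decrease to their limit. Hence the
  upper bound can use finite products without an error term.\<close>

lemma twin_prime_const_le:
  "twin_prime_const \<le> (\<Prod>p\<in>odd_primes_upto y. 1 - 1 / (real p - 1)\<^sup>2)"
proof (rule decseq_ge[OF _ twin_prime_const_limit])
  show "decseq (\<lambda>y. \<Prod>p\<in>odd_primes_upto y. 1 - 1 / (real p - 1)\<^sup>2)"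
  proof (rule decseq_SucI)
    fix n
    have "(\<Prod>p\<in>odd_primes_upto (Suc n). 1 - 1 / (real p - 1)\<^sup>2) =
      (\<Prod>p\<in>odd_primes_upto (Suc n) - odd_primes_upto n. 1 - 1 / (real p - 1)\<^sup>2) *
      (\<Prod>p\<in>odd_primes_upto n. 1 - 1 / (real p - 1)\<^sup>2)"
      by (rule prod.subset_diff) (auto simp: odd_primes_upto_def)
    also have "\<dots> \<le> 1 * (\<Prod>p\<in>odd_primes_upto n. 1 - 1 / (real p - 1)\<^sup>2)"
      by (intro mult_right_mono prod_le_1 prod_nonneg conjI twin_factor_bounds)
        (auto simp: odd_primes_upto_def)
    finally show "(\<Prod>p\<in>odd_primes_upto (Suc n). 1 - 1 / (real p - 1)\<^sup>2)
      \<le> (\<Prod>p\<in>odd_primes_upto n. 1 - 1 / (real p - 1)\<^sup>2)" by simp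
  qed
qed

lemma twin_prime_const_mult_le:
  "twin_prime_const * (\<Prod>p\<in>odd_primes_upto y. 1 + weight p / real p) \<le> 1"
proof -
  have "0 \<le> (\<Prod>p\<in>odd_primes_upto y. 1 + weight p / real p)"
    by (intro prod_nonneg) (auto simp: odd_primes_upto_def weight_def)
  from mult_right_mono[OF twin_prime_const_le[of y] this] show ?thesis
    by (simp add: prod_weight_over_mult_twin)
qed

lemma twin_prime_const_mult_limit:
  "(\<lambda>y. twin_prime_const * (\<Prod>p\<in>odd_primes_upto y. 1 + weight p / real p)) \<longlonglongrightarrow> 1"
proof -
  have "(\<Prod>p\<in>odd_primes_upto y. 1 + weight p / real p) =
    inverse (\<Prod>p\<in>odd_primes_upto y. 1 - 1 / (real p - 1)\<^sup>2)" for y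
    using prod_weight_over_mult_twin[of y] by (metis inverse_unique)
  moreover have "(\<lambda>y. twin_prime_const * inverse (\<Prod>p\<in>odd_primes_upto y. 1 - 1 / (real p - 1)\<^sup>2))
      \<longlonglongrightarrow> twin_prime_const * inverse twin_prime_const"
    by (intro tendsto_intros twin_prime_const_limit twin_prime_const_nonzero)
  ultimately show ?thesis using twin_prime_const_nonzero by simp
qed

section \<open>Convergence of the Romanov series\<close>

definition primes_ord_less :: "nat \<Rightarrow> nat set" where
  "primes_ord_less x = {p. prime p \<and> 2 < p \<and> ord p 2 < x}"

text \<open>A prime with order n divides \<open>2 ^ n - 1\<close>, which has fewer than n prime
  factors since each is at least 2. Summing over n < x gives the count.\<close>

lemma finite_primes_ord_less: "finite (primes_ord_less x)"
  and card_primes_ord_less: "card (primes_ord_less x) \<le> x\<^sup>2"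
proof -
  let ?R = "\<lambda>n. prime_factors (2 ^ n - 1 :: nat)"
  have sub: "primes_ord_less x \<subseteq> (\<Union>n\<in>{1..<x}. ?R n)"
  proof
    fix p assume "p \<in> primes_ord_less x"
    then have p: "prime p" "2 < p" "ord p 2 < x" by (auto simp: primes_ord_less_def)
    \<comment> \<open>\<open>ord\<close> is 0 at non-coprime arguments, so its positivity has to
      come from oddness.\<close>
    have "coprime p 2" using p prime_odd_nat[of p] by simp
    then have pos: "ord p 2 > 0" by simp
    have "[2 ^ ord p 2 = 1] (mod p)" by (rule ord)
    then have "p dvd 2 ^ ord p 2 - 1"
      by (simp add: cong_altdef_nat)
    moreover have "(2::nat) ^ ord p 2 > 1"
      using pos by (intro one_less_power) auto
    ultimately have "p \<in> ?R (ord p 2)" using p by (simp add: in_prime_factors_iff)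
    then show "p \<in> (\<Union>n\<in>{1..<x}. ?R n)" using pos p(3) by (intro UN_I[of "ord p 2"]) (simp_all add: Suc_le_eq del: ord_gt_0_iff)
  qed
  then show "finite (primes_ord_less x)" by (rule finite_subset) auto
  have le: "card (?R n) \<le> x" if "n \<in> {1..<x}" for n
  proof -
    have "(2::nat) ^ n > 1" using that by (intro one_less_power) auto
    then have "2 ^ card (?R n) \<le> (2 ^ n - 1 :: nat)"
      by (intro power_card_le_dvd) (auto simp: in_prime_factors_iff prime_ge_2_nat)
    also have "\<dots> < 2 ^ n" by simp
    finally have "card (?R n) < n" by simp
    then show ?thesis using that by simp
  qed
  have "card (primes_ord_less x) \<le> card (\<Union>n\<in>{1..<x}. ?R n)"
    by (rule card_mono[OF _ sub]) auto
  also have "\<dots> \<le> (\<Sum>n\<in>{1..<x}. card (?R n))"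
    by (rule card_UN_le) auto
  also have "\<dots> \<le> (\<Sum>n\<in>{1..<x}. x)" by (rule sum_mono[OF le])
  also have "\<dots> \<le> x\<^sup>2" by (simp add: power2_eq_square)
  finally show "card (primes_ord_less x) \<le> x\<^sup>2" .
qed

lemma gfun_nonneg: "0 \<le> gfun n"
proof -
  have "2 < p" if "odd n" "p \<in> prime_factors n" for p
    using that by (metis in_prime_factors_iff nat_less_le prime_ge_2_nat)
  then show ?thesis
    unfolding gfun_def by (auto intro!: prod_nonneg) (metis less_imp_le)
qed

lemma prod_prime_factors_squarefree:
  fixes n :: nat
  assumes "squarefree n"
  shows "\<Prod>(prime_factors n) = n"
proof -
  have n: "n \<noteq> 0" using assms by (intro notI) simp
  then have "(\<Prod>p\<in>prime_factors n. p ^ multiplicity p n) = \<Prod>(prime_factors n)"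
    using assms squarefree_factorial_semiring'[OF n] by (intro prod.cong) auto
  with n show ?thesis using prod_prime_factors[of n] by simp
qed

text \<open>If p divides \<open>\<beta>\<close> then \<open>ord p 2\<close> divides
  \<open>ord \<beta> 2\<close>, so all prime factors of \<open>\<beta>\<close> lie in
  \<open>primes_ord_less x\<close>. Squarefree numbers are determined by these factors, and summing
  over all subsets gives the product.\<close>

lemma sum_gfun_ord_less_le:
  assumes "finite F" "\<And>\<beta>. \<beta> \<in> F \<Longrightarrow> odd \<beta> \<and> ord \<beta> 2 < x"
  shows "(\<Sum>\<beta>\<in>F. gfun \<beta>) \<le> (\<Prod>p\<in>primes_ord_less x. 1 + weight p)"
proof -
  let ?F = "{\<beta> \<in> F. squarefree \<beta>}"
  have pf: "prime_factors \<beta> \<subseteq> primes_ord_less x" if "\<beta> \<in> F" for \<beta>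
  proof
    fix p assume p: "p \<in> prime_factors \<beta>"
    then have pd: "prime p" "p dvd \<beta>" by auto
    have odd: "odd \<beta>" "ord \<beta> 2 < x" using assms(2)[OF that] by auto
    then have "p \<noteq> 2" using pd by auto
    then have "2 < p" using prime_ge_2_nat[OF pd(1)] by simp
    have "[2 ^ ord \<beta> 2 = 1] (mod p)"
      by (rule cong_dvd_modulus_nat[OF ord pd(2)])
    then have "ord p 2 dvd ord \<beta> 2" by (simp only: ord_divides)
    moreover have "ord \<beta> 2 > 0" using odd by simp
    ultimately have "ord p 2 \<le> ord \<beta> 2" by (intro dvd_imp_le)
    with odd pd \<open>2 < p\<close> show "p \<in> primes_ord_less x" by (simp add: primes_ord_less_def)
  qed
  have inj: "inj_on prime_factors ?F"
  proof (rule inj_onI)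
    fix a b assume "a \<in> ?F" "b \<in> ?F" and eq: "prime_factors a = prime_factors b"
    then have "\<Prod>(prime_factors a) = a" "\<Prod>(prime_factors b) = b"
      by (blast intro: prod_prime_factors_squarefree)+
    then show "a = b" using eq by metis
  qed
  have "(\<Sum>\<beta>\<in>F. gfun \<beta>) = (\<Sum>\<beta>\<in>?F. gfun \<beta>)"
    by (rule sum.mono_neutral_right) (use assms in \<open>auto simp: gfun_def\<close>)
  also have "\<dots> = (\<Sum>\<beta>\<in>?F. prod weight (prime_factors \<beta>))"
    by (rule sum.cong) (use assms in \<open>auto simp: gfun_def weight_def\<close>)
  also have "\<dots> = (\<Sum>A\<in>prime_factors ` ?F. prod weight A)"
    using inj by (simp add: sum.reindex)
  also have "\<dots> \<le> (\<Sum>A\<in>Pow (primes_ord_less x). prod weight A)"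
  proof (rule sum_mono2)
    show "prime_factors ` ?F \<subseteq> Pow (primes_ord_less x)" using pf by auto
    show "0 \<le> prod weight A" if "A \<in> Pow (primes_ord_less x) - prime_factors ` ?F" for A
      using that by (intro prod_nonneg weight_nonneg) (auto simp: primes_ord_less_def)
  qed (simp add: finite_primes_ord_less)
  also have "\<dots> = (\<Prod>p\<in>primes_ord_less x. 1 + weight p)"
    by (simp add: prod_one_plus_eq_sum_Pow finite_primes_ord_less)
  finally show ?thesis .
qed

text \<open>Powers of 8 make the cube root exact: for x = \<open>8 ^ Suc j\<close> the cutoff y =
  x^2 equals \<open>64 ^ Suc j\<close>, with cube root \<open>4 ^ Suc j\<close>.\<close>

lemma sum_gfun_ord_less_bound:
  assumes "finite F" "\<And>\<beta>. \<beta> \<in> F \<Longrightarrow> odd \<beta> \<and> ord \<beta> 2 < 8 ^ Suc j"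
  shows "(\<Sum>\<beta>\<in>F. gfun \<beta>) \<le> 20 * exp 2 * 4 ^ j"
proof -
  let ?Q = "primes_ord_less (8 ^ Suc j)"
  define y :: nat where "y = 64 ^ Suc j"
  let ?W = "\<Prod>p\<in>odd_primes_upto y. 1 + weight p"
  have y: "y \<ge> 64" by (simp add: y_def)
  have "((8::nat) ^ Suc j)\<^sup>2 = y" by (simp add: y_def power2_eq_square flip: power_mult_distrib)
  then have "card ?Q \<le> y" using card_primes_ord_less[of "8 ^ Suc j"] by simp
  \<comment> \<open>With at most y \<le> 2 (y - 1) primes in \<open>?Q\<close>, those above the
    cutoff contribute at most \<open>exp 2\<close>.\<close>
  moreover have "real y \<le> 2 * (real y - 1)" using y by simp
  ultimately have "real (card ?Q) \<le> 2 * (real y - 1)" by linarith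
  then have card: "real (card ?Q) / (real y - 1) \<le> 2"
    using y by (subst pos_divide_le_eq) linarith+
  have "?W ^ 3 \<le> 90 * real y" using y by (intro prod_upto_cube_bound) linarith
  \<comment> \<open>The constant 90 is rounded up to the cube 125.\<close>
  also have "\<dots> \<le> (5 * 4 ^ Suc j) ^ 3"
  proof -
    have "((4::real) ^ Suc j) ^ 3 = 64 ^ Suc j"
      by (simp only: power_mult[symmetric] mult.commute[of _ 3]) (simp only: power_mult, simp)
    then show ?thesis by (simp only: y_def power_mult_distrib of_nat_power) simp
  qed
  finally have W: "?W \<le> 5 * 4 ^ Suc j" by (rule power_le_imp_le_base[of _ 2, simplified]) simp
  have "(\<Sum>\<beta>\<in>F. gfun \<beta>) \<le> (\<Prod>p\<in>?Q. 1 + weight p)"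
    by (rule sum_gfun_ord_less_le[OF assms])
  also have "\<dots> \<le> ?W * exp (real (card ?Q) / (real y - 1))"
    using y by (intro prod_primes_bound finite_primes_ord_less) (auto simp: primes_ord_less_def)
  also have "\<dots> \<le> (5 * 4 ^ Suc j) * exp 2"
    using W card by (intro mult_mono) auto
  finally show ?thesis by (simp add: mult_ac)
qed

text \<open>The block \<open>8 ^ j \<le> ord \<beta> 2 < 8 ^ Suc j\<close> contributes \<open>O((4 / 8) ^ j)\<close>.\<close>

lemma sum_gfun_div_ord_bound:
  assumes "finite F" "\<And>\<beta>. \<beta> \<in> F \<Longrightarrow> odd \<beta> \<and> ord \<beta> 2 < 8 ^ J"
  shows "(\<Sum>\<beta>\<in>F. gfun \<beta> / real (ord \<beta> 2)) \<le> 40 * exp 2 * (1 - (1 / 2) ^ J)"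
  using assms
proof (induction J arbitrary: F)
  case 0
  \<comment> \<open>Orders of 2 modulo odd numbers are positive, so none lies below
    \<open>8 ^ 0\<close>.\<close>
  have "F = {}"
  proof (rule ccontr)
    assume "F \<noteq> {}"
    then obtain \<beta> where "\<beta> \<in> F" by auto
    with 0(2)[of \<beta>] have "odd \<beta>" "ord \<beta> 2 = 0" by auto
    then show False by (simp add: ord_eq_0)
  qed
  then show ?case by simp
next
  case (Suc J)
  let ?S = "{\<beta> \<in> F. ord \<beta> 2 < 8 ^ J}" and ?L = "{\<beta> \<in> F. \<not> ord \<beta> 2 < 8 ^ J}"
  have "(\<Sum>\<beta>\<in>?L. gfun \<beta> / real (ord \<beta> 2)) \<le> (\<Sum>\<beta>\<in>?L. gfun \<beta> / 8 ^ J)"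
  proof (rule sum_mono)
    fix \<beta> assume "\<beta> \<in> ?L"
    then have "8 ^ J \<le> ord \<beta> 2" by simp
    then have "(8::real) ^ J \<le> real (ord \<beta> 2)"
      by (metis of_nat_le_iff of_nat_numeral of_nat_power)
    then show "gfun \<beta> / real (ord \<beta> 2) \<le> gfun \<beta> / 8 ^ J"
      by (intro divide_left_mono gfun_nonneg mult_pos_pos) (auto intro: less_le_trans[of 0 "8 ^ J"])
  qed
  also have "\<dots> = (\<Sum>\<beta>\<in>?L. gfun \<beta>) / 8 ^ J" by (simp add: sum_divide_distrib)
  also have "\<dots> \<le> (20 * exp 2 * 4 ^ J) / 8 ^ J"
    using Suc.prems by (intro divide_right_mono sum_gfun_ord_less_bound) auto
  also have "\<dots> = 20 * exp 2 * (4 / 8) ^ J"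
    by (simp only: power_divide times_divide_eq_right)
  also have "4 / 8 = (1 / 2 :: real)" by simp
  finally have L: "(\<Sum>\<beta>\<in>?L. gfun \<beta> / real (ord \<beta> 2)) \<le> 20 * exp 2 * (1 / 2) ^ J" .
  have S: "(\<Sum>\<beta>\<in>?S. gfun \<beta> / real (ord \<beta> 2)) \<le> 40 * exp 2 * (1 - (1 / 2) ^ J)"
    using Suc.prems by (intro Suc.IH) auto
  have "(\<Sum>\<beta>\<in>F. gfun \<beta> / real (ord \<beta> 2)) =
    (\<Sum>\<beta>\<in>?S. gfun \<beta> / real (ord \<beta> 2)) + (\<Sum>\<beta>\<in>?L. gfun \<beta> / real (ord \<beta> 2))"
    using Suc.prems(1) by (subst sum.union_disjoint[symmetric]) (auto intro!: sum.cong)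
  \<comment> \<open>The form of the bound makes this exact: 40 (1 - q) + 20 q = 40 (1 - q / 2) for q
    = \<open>(1 / 2) ^ J\<close>.\<close>
  with L S show ?case by (simp add: algebra_simps)
qed

lemma C_Rom_summable:
  "(\<lambda>\<beta>. gfun \<beta> / real (ord \<beta> 2)) summable_on {\<beta>::nat. odd \<beta>}"
proof (rule nonneg_bdd_above_summable_on)
  show "bdd_above (sum (\<lambda>\<beta>. gfun \<beta> / real (ord \<beta> 2)) ` {F. F \<subseteq> {\<beta>::nat. odd \<beta>} \<and> finite F})"
  proof (rule bdd_aboveI2)
    fix F :: "nat set" assume "F \<in> {F. F \<subseteq> {\<beta>::nat. odd \<beta>} \<and> finite F}"
    then have F: "F \<subseteq> {\<beta>. odd \<beta>}" "finite F" by auto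
    \<comment> \<open>Any \<open>J\<close> with all orders below \<open>8 ^ J\<close> would do; the
      sum dominates each order, and the final bound is free of \<open>J\<close>.\<close>
    define J where "J = (\<Sum>\<beta>\<in>F. ord \<beta> 2)"
    have "ord \<beta> 2 < 8 ^ J" if "\<beta> \<in> F" for \<beta>
    proof -
      have "ord \<beta> 2 \<le> J" unfolding J_def using F that by (intro member_le_sum) auto
      also have "J < 8 ^ J" by (rule power_gt_expt) simp
      finally show ?thesis .
    qed
    then have "(\<Sum>\<beta>\<in>F. gfun \<beta> / real (ord \<beta> 2)) \<le> 40 * exp 2 * (1 - (1 / 2) ^ J)"
      using F by (intro sum_gfun_div_ord_bound) auto
    also have "\<dots> \<le> 40 * exp 2" by simp
    finally show "(\<Sum>\<beta>\<in>F. gfun \<beta> / real (ord \<beta> 2)) \<le> 40 * exp 2" .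
  qed
qed (simp add: gfun_nonneg)

text \<open>\<open>gfun\<close> vanishes off the squarefree numbers, and on them the squared Moebius
  value is 1.\<close>

lemma C_Rom_eq: "C_Rom = (\<Sum>\<^sub>\<infinity>\<beta>\<in>{\<beta>::nat. odd \<beta>}. gfun \<beta> / real (ord \<beta> 2))"
proof -
  have "(real_of_int (moebius \<beta>))\<^sup>2 * gfun \<beta> = gfun \<beta>" for \<beta>
    by (auto simp: moebius_def gfun_def simp flip: power_mult)
  then show ?thesis unfolding C_Rom_def by (simp only:)
qed

text \<open>By unique factorization distinct sets of primes have distinct products, so this is a
  finite partial sum of a nonnegative series.\<close>

lemma sum_Pow_le_C_Rom:
  assumes "finite P" "\<And>p. p \<in> P \<Longrightarrow> prime p \<and> 2 < p"
  shows "(\<Sum>A\<in>Pow P. prod weight A / real (ord (\<Prod>A) 2)) \<le> C_Rom"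
proof -
  have A: "finite A" "\<And>p. p \<in> A \<Longrightarrow> prime p \<and> 2 < p" if "A \<in> Pow P" for A
    using that assms by (auto intro: finite_subset)
  have inj: "inj_on Prod (Pow P)"
    by (rule inj_on_inverseI[of _ prime_factors]) (simp add: A prime_factors_prod_primes)
  have "(\<Sum>A\<in>Pow P. prod weight A / real (ord (\<Prod>A) 2)) =
    (\<Sum>A\<in>Pow P. gfun (\<Prod>A) / real (ord (\<Prod>A) 2))"
    by (rule sum.cong) (simp_all add: A gfun_prod_primes)
  also have "\<dots> = (\<Sum>\<beta>\<in>Prod ` Pow P. gfun \<beta> / real (ord \<beta> 2))"
    using inj by (simp add: sum.reindex)
  also have "\<dots> \<le> C_Rom"
    unfolding C_Rom_eq
    by (rule finite_sum_le_infsum[OF C_Rom_summable])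
      (use assms(1) in \<open>auto simp: gfun_nonneg A prod_odd_primes_odd\<close>)
  finally show ?thesis .
qed

subsection \<open>The upper bound\<close>

text \<open>The exchange of summation behind both bounds: each product is expanded over sets
  \<open>A\<close>, and summing over x first leaves a weighted count of the x that satisfy
  \<open>Q\<close> for all of \<open>A\<close>.\<close>

lemma sum_mult_prod_one_plus_filter:
  fixes f :: "'a \<Rightarrow> 'c::comm_semiring_1"
  assumes "finite P" "finite E"
  shows "(\<Sum>x\<in>E. c x * (\<Prod>p\<in>{p \<in> P. Q p x}. 1 + f p)) =
    (\<Sum>A\<in>Pow P. prod f A * (\<Sum>x\<in>{x \<in> E. \<forall>p\<in>A. Q p x}. c x))"
proof -
  have "(\<Sum>x\<in>E. c x * (\<Prod>p\<in>{p \<in> P. Q p x}. 1 + f p)) =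
    (\<Sum>x\<in>E. \<Sum>A\<in>Pow P. if \<forall>p\<in>A. Q p x then prod f A * c x else 0)"
    using assms(1)
    by (simp add: prod_one_plus_filter_eq_sum_Pow sum_distrib_left if_distrib mult.commute cong: if_cong)
  also have "\<dots> = (\<Sum>A\<in>Pow P. \<Sum>x\<in>E. if \<forall>p\<in>A. Q p x then prod f A * c x else 0)"
    by (rule sum.swap)
  also have "\<dots> = (\<Sum>A\<in>Pow P. prod f A * (\<Sum>x\<in>{x \<in> E. \<forall>p\<in>A. Q p x}. c x))"
    using assms(2)
    by (intro sum.cong refl) (auto simp: sum.inter_filter sum_distrib_left intro!: sum.cong)
  finally show ?thesis .
qed

section \<open>Size of d and its large prime factors\<close>

lemma dval_bounds:
  assumes "h \<ge> 1" "k \<ge> 1"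
  shows "0 < dval k h" "dval k h < 2 ^ (k + h)"
proof -
  have "int h < 2 ^ h" using less_exp[of h] by (metis of_nat_less_iff of_nat_numeral of_nat_power)
  moreover have "(2::int) ^ 1 \<le> 2 ^ k" using assms by (intro power_increasing) auto
  \<comment> \<open>Here \<open>2 ^ k \<ge> 2\<close> and \<open>2 ^ h - 1 \<ge> h\<close>, so d is
    at least h.\<close>
  ultimately have "2 * int h \<le> 2 ^ k * (2 ^ h - 1)"
    by (intro mult_mono) auto
  then show "0 < dval k h" using assms by (simp add: dval_def)
  have "dval k h < 2 ^ k * 2 ^ h" using assms by (simp add: dval_def algebra_simps add_pos_nonneg)
  then show "dval k h < 2 ^ (k + h)" by (simp add: power_add)
qed

text \<open>If m primes above K divide d then \<open>K ^ m < 2 ^ K\<close>, so m is at most K / log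
  2 K; each contributes a factor at most exp (1 / (K - 1)).\<close>

lemma singular_series_le:
  assumes "K \<ge> 2" "0 < d" "d < 2 ^ K"
  shows "singular_series d \<le> 2 * twin_prime_const *
    ((\<Prod>p\<in>{p \<in> odd_primes_upto K. int p dvd d}. 1 + weight p) *
     exp (real K / log 2 (real K) / (real K - 1)))"
proof -
  let ?D = "{p. prime p \<and> 2 < p \<and> int p dvd d}"
  let ?S = "{p \<in> odd_primes_upto K. int p dvd d}" and ?L = "{p \<in> ?D. K < p}"
  have finL: "finite ?L"
    by (rule finite_subset[OF _ finite_prime_divisors[of d]]) (use assms(2) in auto)
  have "K ^ card ?L \<le> nat d"
  proof (rule power_card_le_dvd[OF finL])
    show "prime q \<and> K \<le> q \<and> q dvd nat d" if "q \<in> ?L" for q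
      using that assms(2) by (simp add: int_dvd_int_iff[symmetric])
  qed (use assms in simp)
  then have "int (K ^ card ?L) < 2 ^ K" using assms by linarith
  then have "real (K ^ card ?L) < 2 ^ K"
    by (metis of_int_less_iff of_int_of_nat_eq of_int_power of_int_numeral)
  then have "log 2 (real (K ^ card ?L)) \<le> log 2 (2 ^ K)"
    using assms(1) by (subst log_le_cancel_iff) auto
  then have "real (card ?L) * log 2 (real K) \<le> real K"
    using assms(1) by (simp add: log_nat_power)
  moreover have "log 2 (real K) > 0" using assms(1) by simp
  ultimately have "real (card ?L) \<le> real K / log 2 (real K)"
    by (simp add: pos_le_divide_eq)
  then have "exp (real (card ?L) / (real K - 1)) \<le> exp (real K / log 2 (real K) / (real K - 1))"
    using assms(1) unfolding exp_le_cancel_iff by (intro divide_right_mono) auto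
  moreover have "(\<Prod>p\<in>?L. 1 + weight p) \<le> exp (real (card ?L) / (real K - 1))"
    using assms(1) by (intro prod_large_primes_bound) auto
  ultimately have L: "(\<Prod>p\<in>?L. 1 + weight p) \<le> exp (real K / log 2 (real K) / (real K - 1))"
    by linarith
  have finS: "finite ?S" by simp
  have D: "?D = ?S \<union> ?L" by (auto simp: odd_primes_upto_def)
  have "(\<Prod>p\<in>?D. 1 + weight p) = (\<Prod>p\<in>?S. 1 + weight p) * (\<Prod>p\<in>?L. 1 + weight p)"
    by (subst D, rule prod.union_disjoint[OF finS finL]) (auto simp: odd_primes_upto_def)
  also have "\<dots> \<le> (\<Prod>p\<in>?S. 1 + weight p) * exp (real K / log 2 (real K) / (real K - 1))"
    using L by (intro mult_left_mono prod_nonneg) (auto simp: odd_primes_upto_def weight_def)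
  finally show ?thesis
    using assms(2) twin_prime_const_nonneg by (simp add: singular_series_eq mult_left_mono)
qed

section \<open>Counting and summing over k\<close>

lemma card_le_if_cong:
  assumes "S \<subseteq> {1..L}" "r > 0" "\<And>k l. k \<in> S \<Longrightarrow> l \<in> S \<Longrightarrow> [k = l] (mod r)"
  shows "real (card S) \<le> real L / real r + 1"
proof -
  \<comment> \<open>Within one class modulo \<open>r\<close> the quotient determines the number;
    there are at most \<open>L div r + 1\<close> quotients.\<close>
  have "inj_on (\<lambda>k. k div r) S"
  proof (rule inj_onI)
    fix k l assume "k \<in> S" "l \<in> S" "k div r = l div r"
    then show "k = l"
      using assms(3)[of k l] by (metis cong_def div_mult_mod_eq)
  qed
  moreover have "(\<lambda>k. k div r) ` S \<subseteq> {..L div r}"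
    using assms(1) by (auto intro!: div_le_mono)
  ultimately have "card S \<le> card {..L div r}"
    by (intro card_inj_on_le) auto
  then have "real (card S) \<le> real (L div r) + 1" by simp
  also have "real (L div r) \<le> real L / real r" by (rule of_nat_div_le_of_nat)
  finally show ?thesis by simp
qed

text \<open>For fixed h the linear term cancels in the difference of two values of d, and the
  coprime factor \<open>2 ^ h - 1\<close> can be divided out, leaving a congruence between powers of
  2.\<close>

lemma card_dvd_dval_le:
  assumes "odd \<beta>" "coprime (int \<beta>) (2 ^ h - 1)"
  shows "real (card {k \<in> {1..L}. int \<beta> dvd dval k h}) \<le> real L / real (ord \<beta> 2) + 1"
proof (rule card_le_if_cong)
  have cop: "coprime \<beta> 2" using assms(1) by simp
  then show "ord \<beta> 2 > 0" by simp
  fix k l assume "k \<in> {k \<in> {1..L}. int \<beta> dvd dval k h}" "l \<in> {k \<in> {1..L}. int \<beta> dvd dval k h}"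
  then have "int \<beta> dvd dval k h - dval l h" by (intro dvd_diff) auto
  also have "dval k h - dval l h = (2 ^ k - 2 ^ l) * (2 ^ h - 1)"
    by (simp add: dval_def algebra_simps)
  finally have "int \<beta> dvd 2 ^ k - 2 ^ l"
    using assms(2) coprime_dvd_mult_left_iff by blast
  then have "[int (2 ^ k) = int (2 ^ l)] (mod int \<beta>)"
    by (simp add: cong_iff_dvd_diff)
  then have "[2 ^ k = 2 ^ l] (mod \<beta>)" by (simp only: cong_int_iff)
  then show "[k = l] (mod ord \<beta> 2)"
    using order_divides_expdiff[OF cop] by simp
qed auto

text \<open>The set \<open>P\<close> is split by divisibility of \<open>2 ^ h - 1\<close>. Divisors
  of it matter only if they divide h, and are bounded uniformly in k; the others are counted by
  orders. The \<open>+ 1\<close> of each count adds up to the last product.\<close>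

lemma sum_over_k_bound:
  assumes P: "finite P" "\<And>p. p \<in> P \<Longrightarrow> prime p \<and> 2 < p"
  shows "(\<Sum>k\<in>{1..L}. \<Prod>p\<in>{p \<in> P. int p dvd dval k h}. 1 + weight p) \<le>
    (\<Prod>p\<in>{p \<in> P. p dvd h}. 1 + weight p) * (real L * C_Rom + (\<Prod>p\<in>P. 1 + weight p))"
proof -
  let ?G = "\<Prod>p\<in>{p \<in> P. p dvd h}. 1 + weight p"
  define P1 where "P1 = {p \<in> P. int p dvd 2 ^ h - 1}"
  define P2 where "P2 = {p \<in> P. \<not> int p dvd 2 ^ h - 1}"
  have fin: "finite P1" "finite P2" and sub: "P1 \<subseteq> P" "P2 \<subseteq> P"
    using P(1) by (auto simp: P1_def P2_def)
  have w: "0 \<le> weight p" if "p \<in> P" for p using P(2)[OF that] by (simp add: weight_nonneg)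
  have wP: "0 \<le> prod weight A" if "A \<subseteq> P" for A using that w by (intro prod_nonneg) auto
  have pt: "(\<Prod>p\<in>{p \<in> P. int p dvd dval k h}. 1 + weight p)
    \<le> ?G * (\<Prod>p\<in>{p \<in> P2. int p dvd dval k h}. 1 + weight p)" for k
  proof -
    have "{p \<in> P. int p dvd dval k h} = {p \<in> P1. int p dvd dval k h} \<union> {p \<in> P2. int p dvd dval k h}"
      by (auto simp: P1_def P2_def)
    moreover have "{p \<in> P1. int p dvd dval k h} \<inter> {p \<in> P2. int p dvd dval k h} = {}"
      by (auto simp: P1_def P2_def)
    ultimately have "(\<Prod>p\<in>{p \<in> P. int p dvd dval k h}. 1 + weight p) =
      (\<Prod>p\<in>{p \<in> P1. int p dvd dval k h}. 1 + weight p) *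
      (\<Prod>p\<in>{p \<in> P2. int p dvd dval k h}. 1 + weight p)"
      using fin by (simp add: prod.union_disjoint)
    moreover have "(\<Prod>p\<in>{p \<in> P1. int p dvd dval k h}. 1 + weight p) \<le> ?G"
    proof (rule prod_mono2)
      show "{p \<in> P1. int p dvd dval k h} \<subseteq> {p \<in> P. p dvd h}"
      proof
        fix p assume "p \<in> {p \<in> P1. int p dvd dval k h}"
        then have "p \<in> P" "int p dvd 2 ^ h - 1" "int p dvd dval k h" by (auto simp: P1_def)
        \<comment> \<open>This difference is h itself.\<close>
        then have "int p dvd 2 ^ k * (2 ^ h - 1) - dval k h" by (meson dvd_diff dvd_mult)
        then have "int p dvd int h" by (simp add: dval_def)
        with \<open>p \<in> P\<close> show "p \<in> {p \<in> P. p dvd h}" by simp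
      qed
    qed (use P(1) w sub in \<open>auto simp: add_nonneg_nonneg\<close>)
    ultimately show ?thesis
      using w sub by (simp, intro mult_right_mono prod_nonneg) (auto simp: subset_iff)
  qed
  have cnt: "real (card {k \<in> {1..L}. \<forall>p\<in>A. int p dvd dval k h}) \<le> real L / real (ord (\<Prod>A) 2) + 1"
    if "A \<in> Pow P2" for A
  proof -
    have A: "finite A" "\<And>p. p \<in> A \<Longrightarrow> prime p \<and> 2 < p"
      using that sub P by (auto intro: finite_subset)
    have "coprime (int (\<Prod>A)) (2 ^ h - 1)"
      unfolding of_nat_prod
    proof (rule prod_coprime_left)
      fix p assume "p \<in> A"
      then have "prime (int p)" "\<not> int p dvd 2 ^ h - 1" using A that by (auto simp: P2_def)
      then show "coprime (int p) (2 ^ h - 1)" by (rule prime_imp_coprime)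
    qed
    then have "real (card {k \<in> {1..L}. int (\<Prod>A) dvd dval k h}) \<le> real L / real (ord (\<Prod>A) 2) + 1"
      using A by (intro card_dvd_dval_le prod_odd_primes_odd)
    then show ?thesis using A by (simp only: prod_primes_dvd_int_iff)
  qed
  have "(\<Sum>k\<in>{1..L}. \<Prod>p\<in>{p \<in> P. int p dvd dval k h}. 1 + weight p) \<le>
    (\<Sum>k\<in>{1..L}. ?G * (\<Prod>p\<in>{p \<in> P2. int p dvd dval k h}. 1 + weight p))"
    by (intro sum_mono pt)
  also have "\<dots> = ?G * (\<Sum>k\<in>{1..L}. 1 * (\<Prod>p\<in>{p \<in> P2. int p dvd dval k h}. 1 + weight p))"
    by (simp add: sum_distrib_left)
  also have "\<dots> \<le> ?G * (real L * C_Rom + (\<Prod>p\<in>P. 1 + weight p))"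
  proof (rule mult_left_mono)
    have "(\<Sum>k\<in>{1..L}. 1 * (\<Prod>p\<in>{p \<in> P2. int p dvd dval k h}. 1 + weight p)) =
      (\<Sum>A\<in>Pow P2. prod weight A * real (card {k \<in> {1..L}. \<forall>p\<in>A. int p dvd dval k h}))"
      using fin by (subst sum_mult_prod_one_plus_filter) auto
    also have "\<dots> \<le> (\<Sum>A\<in>Pow P2. prod weight A * (real L / real (ord (\<Prod>A) 2) + 1))"
      using sub by (intro sum_mono mult_left_mono cnt wP) auto
    also have "\<dots> = real L * (\<Sum>A\<in>Pow P2. prod weight A / real (ord (\<Prod>A) 2)) + (\<Sum>A\<in>Pow P2. prod weight A)"
      by (simp add: algebra_simps sum.distrib sum_distrib_left)
    also have "\<dots> \<le> real L * C_Rom + (\<Prod>p\<in>P. 1 + weight p)"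
    proof (rule add_mono)
      show "real L * (\<Sum>A\<in>Pow P2. prod weight A / real (ord (\<Prod>A) 2)) \<le> real L * C_Rom"
        using fin sub P by (intro mult_left_mono sum_Pow_le_C_Rom) auto
      show "(\<Sum>A\<in>Pow P2. prod weight A) \<le> (\<Prod>p\<in>P. 1 + weight p)"
        unfolding prod_one_plus_eq_sum_Pow[OF fin(2), symmetric]
        using P(1) sub w by (intro prod_mono2) (auto simp: add_nonneg_nonneg)
    qed
    finally show "(\<Sum>k\<in>{1..L}. 1 * (\<Prod>p\<in>{p \<in> P2. int p dvd dval k h}. 1 + weight p))
      \<le> real L * C_Rom + (\<Prod>p\<in>P. 1 + weight p)" .
  qed (use w in \<open>auto intro!: prod_nonneg\<close>)
  finally show ?thesis .
qed

section \<open>Summing over h\<close>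

lemma even_multiples_sums:
  assumes "odd \<beta>" and H: "H = {h \<in> {h \<in> {1..K - 1}. even h}. \<beta> dvd h}"
  shows "(\<Sum>h\<in>H. real K - real h) \<le> (real K)\<^sup>2 / (4 * real \<beta>)"
    and "real (card H) \<le> real K / real \<beta>"
proof -
  \<comment> \<open>As \<open>\<beta>\<close> is odd, its even multiples are exactly the multiples
    of \<open>b\<close>.\<close>
  define b where "b = 2 * \<beta>"
  define J where "J = (K - 1) div b"
  have b: "b > 0" using assms(1) by (auto simp: b_def intro: Nat.gr0I)
  have H_eq: "H = (\<lambda>j. b * j) ` {1..J}"
  proof (intro equalityI subsetI)
    fix h assume "h \<in> H"
    then have h: "1 \<le> h" "h \<le> K - 1" "even h" "\<beta> dvd h" using H by auto
    have "coprime 2 \<beta>" using assms(1) by simp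
    then have "b dvd h" using h by (simp add: b_def divides_mult)
    then obtain j where j: "h = b * j" by auto
    then have "j = h div b" using b by simp
    then have "j \<le> J" unfolding J_def using h by (simp add: div_le_mono)
    moreover have "1 \<le> j" using h j by (cases j) auto
    ultimately show "h \<in> (\<lambda>j. b * j) ` {1..J}" using j by auto
  next
    fix h assume "h \<in> (\<lambda>j. b * j) ` {1..J}"
    then obtain j where j: "h = b * j" "1 \<le> j" "j \<le> J"
      by (metis (no_types, lifting) atLeastAtMost_iff imageE)
    have "b * j \<le> b * J" using j by simp
    also have "\<dots> \<le> K - 1" unfolding J_def by simp
    finally have "h \<le> K - 1" using j by simp
    moreover have "h \<ge> 1" using j b by simp
    ultimately show "h \<in> H" unfolding H using j by (auto simp: b_def)
  qed
  have inj: "inj_on (\<lambda>j. b * j) {1..J}" using b by (auto intro: inj_onI)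
  have gauss: "(\<Sum>j\<in>{1..n}. real K - real (b * j)) = real n * real K - real b * (real n * (real n + 1)) / 2" for n
    by (induction n) (auto simp: field_simps)
  have "(\<Sum>h\<in>H. real K - real h) = real J * real K - real b * (real J * (real J + 1)) / 2"
    unfolding H_eq using inj gauss[of J] by (simp add: sum.reindex)
  also have "\<dots> \<le> real J * real K - real b * (real J)\<^sup>2 / 2"
    using b by (simp add: power2_eq_square algebra_simps)
  also have "\<dots> \<le> (real K)\<^sup>2 / (2 * real b)"
  proof -
    \<comment> \<open>Completing the square: J K - b J^2 / 2 is at most K^2 / (2 b) for every J, so
      rounding in \<open>J\<close> causes no error term.\<close>
    have "0 \<le> (real K - real b * real J)\<^sup>2" by simp
    then have "2 * real b * (real J * real K) - (real b)\<^sup>2 * (real J)\<^sup>2 \<le> (real K)\<^sup>2"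
      by (simp add: power2_eq_square algebra_simps)
    then show ?thesis using b by (simp add: field_simps power2_eq_square)
  qed
  finally show "(\<Sum>h\<in>H. real K - real h) \<le> (real K)\<^sup>2 / (4 * real \<beta>)"
    by (simp add: b_def)
  have "real (card H) = real J" unfolding H_eq using inj by (simp add: card_image)
  also have "\<dots> \<le> real (K - 1) / real b" unfolding J_def by (rule of_nat_div_le_of_nat)
  also have "\<dots> \<le> real K / real \<beta>"
    using b by (intro frac_le) (auto simp: b_def)
  finally show "real (card H) \<le> real K / real \<beta>" .
qed

text \<open>The weight K - h is the number of k for a given h and belongs to the main term; the
  unweighted sum accompanies the \<open>+ 1\<close> errors of the counts in k.\<close>

lemma sum_over_h_bounds:
  assumes P: "finite P" "\<And>p. p \<in> P \<Longrightarrow> prime p \<and> 2 < p"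
    and E: "E = {h \<in> {1..K - 1}. even h}"
  shows "(\<Sum>h\<in>E. (real K - real h) * (\<Prod>p\<in>{p \<in> P. p dvd h}. 1 + weight p))
      \<le> (real K)\<^sup>2 / 4 * (\<Prod>p\<in>P. 1 + weight p / real p)"
    and "(\<Sum>h\<in>E. \<Prod>p\<in>{p \<in> P. p dvd h}. 1 + weight p) \<le> real K * (\<Prod>p\<in>P. 1 + weight p / real p)"
proof -
  have finE: "finite E" unfolding E by simp
  have A: "finite A" "\<And>p. p \<in> A \<Longrightarrow> prime p \<and> 2 < p" "0 \<le> prod weight A"
    and H: "{h \<in> E. \<forall>p\<in>A. p dvd h} = {h \<in> {h \<in> {1..K - 1}. even h}. \<Prod>A dvd h}"
    if "A \<in> Pow P" for A
  proof -
    show *: "finite A" "\<And>p. p \<in> A \<Longrightarrow> prime p \<and> 2 < p"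
      using that P by (auto intro: finite_subset)
    then show "0 \<le> prod weight A" by (intro prod_nonneg) (auto simp: weight_nonneg)
    show "{h \<in> E. \<forall>p\<in>A. p dvd h} = {h \<in> {h \<in> {1..K - 1}. even h}. \<Prod>A dvd h}"
      unfolding E using * by (simp add: prod_primes_dvd_iff)
  qed
  have V: "(\<Prod>p\<in>P. 1 + weight p / real p) = (\<Sum>A\<in>Pow P. prod weight A / real (\<Prod>A))"
    using P(1) by (simp add: prod_one_plus_eq_sum_Pow prod_dividef)
  have "(\<Sum>h\<in>E. (real K - real h) * (\<Prod>p\<in>{p \<in> P. p dvd h}. 1 + weight p)) =
    (\<Sum>A\<in>Pow P. prod weight A * (\<Sum>h\<in>{h \<in> E. \<forall>p\<in>A. p dvd h}. real K - real h))"
    by (rule sum_mult_prod_one_plus_filter[OF P(1) finE])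
  also have "\<dots> \<le> (\<Sum>A\<in>Pow P. prod weight A * ((real K)\<^sup>2 / (4 * real (\<Prod>A))))"
    by (intro sum_mono mult_left_mono A even_multiples_sums(1)[OF _ H] prod_odd_primes_odd)
  also have "\<dots> = (real K)\<^sup>2 / 4 * (\<Prod>p\<in>P. 1 + weight p / real p)"
    unfolding V by (simp add: sum_distrib_left mult_ac)
  finally show "(\<Sum>h\<in>E. (real K - real h) * (\<Prod>p\<in>{p \<in> P. p dvd h}. 1 + weight p))
      \<le> (real K)\<^sup>2 / 4 * (\<Prod>p\<in>P. 1 + weight p / real p)" .
  have "(\<Sum>h\<in>E. \<Prod>p\<in>{p \<in> P. p dvd h}. 1 + weight p) =
    (\<Sum>A\<in>Pow P. prod weight A * real (card {h \<in> E. \<forall>p\<in>A. p dvd h}))"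
    using sum_mult_prod_one_plus_filter[OF P(1) finE, where c = "\<lambda>_. 1" and Q = "(dvd)" and f = weight] by simp
  also have "\<dots> \<le> (\<Sum>A\<in>Pow P. prod weight A * (real K / real (\<Prod>A)))"
    by (intro sum_mono mult_left_mono A even_multiples_sums(2)[OF _ H] prod_odd_primes_odd)
  also have "\<dots> = real K * (\<Prod>p\<in>P. 1 + weight p / real p)"
    unfolding V by (simp add: sum_distrib_left mult_ac)
  finally show "(\<Sum>h\<in>E. \<Prod>p\<in>{p \<in> P. p dvd h}. 1 + weight p) \<le> real K * (\<Prod>p\<in>P. 1 + weight p / real p)" .
qed

text \<open>\<open>Phi\<close> depends on N only through \<open>Kfun N\<close>; all estimates are
  made in K.\<close>

definition singular_mean :: "nat \<Rightarrow> real" where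
  "singular_mean K = 1 / (real K)\<^sup>2 *
     (\<Sum>h\<in>{h \<in> {1..K - 1}. even h}. \<Sum>k\<in>{1..K - h}. singular_series (dval k h))"

lemma C_Rom_nonneg: "0 \<le> C_Rom"
  unfolding C_Rom_eq by (rule infsum_nonneg) (simp add: gfun_nonneg)

lemma singular_mean_le:
  assumes "K \<ge> 2"
  shows "singular_mean K \<le> exp (real K / log 2 (real K) / (real K - 1)) *
    (C_Rom / 2 + 2 * (\<Prod>p\<in>odd_primes_upto K. 1 + weight p) / real K)"
proof -
  let ?P = "odd_primes_upto K"
  let ?W = "\<Prod>p\<in>?P. 1 + weight p" and ?V = "\<Prod>p\<in>?P. 1 + weight p / real p"
  let ?X = "exp (real K / log 2 (real K) / (real K - 1))"
  let ?G = "\<lambda>h. \<Prod>p\<in>{p \<in> ?P. p dvd h}. 1 + weight p"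
  let ?C = "twin_prime_const"
  define E where "E = {h \<in> {1..K - 1}. even h}"
  have P: "finite ?P" "\<And>p. p \<in> ?P \<Longrightarrow> prime p \<and> 2 < p" by (auto simp: odd_primes_upto_def)
  have C: "0 \<le> ?C" by (rule twin_prime_const_nonneg)
  have h: "(\<Sum>k\<in>{1..K - h}. singular_series (dval k h)) \<le>
    2 * ?C * ?X * (?G h * ((real K - real h) * C_Rom + ?W))" if "h \<in> E" for h
  proof -
    have hK: "1 \<le> h" "h \<le> K" using that by (auto simp: E_def)
    have "(\<Sum>k\<in>{1..K - h}. singular_series (dval k h)) \<le>
      (\<Sum>k\<in>{1..K - h}. 2 * ?C * ((\<Prod>p\<in>{p \<in> ?P. int p dvd dval k h}. 1 + weight p) * ?X))"
    proof (rule sum_mono)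
      fix k assume k: "k \<in> {1..K - h}"
      then have "dval k h < 2 ^ (k + h)" using hK by (intro dval_bounds) auto
      also have "\<dots> \<le> 2 ^ K" using k hK by (intro power_increasing) auto
      finally show "singular_series (dval k h) \<le>
        2 * ?C * ((\<Prod>p\<in>{p \<in> ?P. int p dvd dval k h}. 1 + weight p) * ?X)"
        using k hK by (intro singular_series_le[OF assms] dval_bounds) auto
    qed
    also have "\<dots> = 2 * ?C * ?X * (\<Sum>k\<in>{1..K - h}. \<Prod>p\<in>{p \<in> ?P. int p dvd dval k h}. 1 + weight p)"
      by (simp add: sum_distrib_left mult_ac)
    also have "\<dots> \<le> 2 * ?C * ?X * (?G h * (real (K - h) * C_Rom + ?W))"
      using C by (intro mult_left_mono sum_over_k_bound P) auto
    finally show ?thesis using hK by (simp add: of_nat_diff)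
  qed
  have "(\<Sum>h\<in>E. \<Sum>k\<in>{1..K - h}. singular_series (dval k h)) \<le>
    (\<Sum>h\<in>E. 2 * ?C * ?X * (?G h * ((real K - real h) * C_Rom + ?W)))"
    by (rule sum_mono[OF h])
  also have "\<dots> = 2 * ?C * ?X * (C_Rom * (\<Sum>h\<in>E. (real K - real h) * ?G h) + ?W * (\<Sum>h\<in>E. ?G h))"
    unfolding sum_distrib_left sum.distrib[symmetric]
    by (intro sum.cong refl) (simp add: algebra_simps)
  also have "\<dots> \<le> 2 * ?C * ?X * (C_Rom * ((real K)\<^sup>2 / 4 * ?V) + ?W * (real K * ?V))"
    using C by (intro mult_left_mono add_mono sum_over_h_bounds[OF P E_def] C_Rom_nonneg
        prod_upto_nonneg) auto
  \<comment> \<open>Isolating \<open>?C * ?V\<close>, which is at most 1, leaves 2 / 4 as the factor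
    of \<open>C_Rom\<close>.\<close>
  also have "\<dots> = (?C * ?V) * (2 * ?X * (C_Rom * ((real K)\<^sup>2 / 4) + ?W * real K))"
    by (simp add: algebra_simps)
  also have "\<dots> \<le> 1 * (2 * ?X * (C_Rom * ((real K)\<^sup>2 / 4) + ?W * real K))"
    by (intro mult_right_mono twin_prime_const_mult_le)
      (auto intro!: mult_nonneg_nonneg add_nonneg_nonneg C_Rom_nonneg prod_upto_nonneg)
  finally have "singular_mean K \<le> 1 / (real K)\<^sup>2 * (2 * ?X * (C_Rom * ((real K)\<^sup>2 / 4) + ?W * real K))"
    unfolding singular_mean_def E_def by (intro mult_left_mono) auto
  also have "\<dots> = ?X * (C_Rom / 2 + 2 * ?W / real K)"
    using assms by (simp add: field_simps power2_eq_square)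
  finally show ?thesis .
qed

subsection \<open>The lower bound\<close>

definition dval_dvd :: "nat set \<Rightarrow> nat \<Rightarrow> nat \<Rightarrow> bool" where
  "dval_dvd A k h \<longleftrightarrow> even h \<and> (\<forall>p\<in>A. int p dvd dval k h)"

text \<open>A period in h of \<open>dval_dvd A k\<close>, not always the least: 2 for parity, p for
  h modulo p, and p - 1 for \<open>2 ^ h\<close> modulo p by Fermat.\<close>

definition dval_period :: "nat set \<Rightarrow> nat" where
  "dval_period A = 2 * (\<Prod>p\<in>A. p * (p - 1))"

lemma dval_period_pos:
  assumes "\<And>p. p \<in> A \<Longrightarrow> prime p \<and> 2 < p"
  shows "dval_period A > 0"
proof -
  have "0 < p * (p - 1)" if "p \<in> A" for p using assms[OF that] by simp
  then show ?thesis unfolding dval_period_def by (simp add: prod_pos)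
qed

lemma two_power_cong:
  assumes "prime p" "2 < p" "[h = l] (mod (p - 1))"
  shows "[(2::int) ^ h = 2 ^ l] (mod int p)"
proof -
  have cop: "coprime p 2" using assms prime_odd_nat[of p] by simp
  have "ord p 2 dvd p - 1"
    using order_divides_totient[OF cop] assms(1) by (simp add: totient_prime)
  then have "[h = l] (mod ord p 2)" by (rule cong_dvd_modulus_nat[OF assms(3)])
  then have "[2 ^ h = 2 ^ l] (mod p)" using order_divides_expdiff[OF cop] by simp
  then show ?thesis by (metis cong_int_iff of_nat_numeral of_nat_power)
qed

text \<open>Adding h back leaves the exponential part of d, which has period p - 1 modulo p; the
  linear term, of period p, is treated separately.\<close>

lemma dval_cong:
  assumes "prime p" "2 < p" "[h = l] (mod (p - 1))"
  shows "[dval k h + int h = dval k l + int l] (mod int p)"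
proof -
  have "[2 ^ k * (2 ^ h - 1) = 2 ^ k * (2 ^ l - 1 :: int)] (mod int p)"
    by (intro cong_mult cong_diff cong_refl two_power_cong assms)
  then show ?thesis by (simp add: dval_def)
qed

text \<open>A multiple \<open>m\<close> of the period is allowed because the induction on
  \<open>A\<close> works with q - 1 times the period.\<close>

lemma dval_dvd_cong:
  assumes "\<And>p. p \<in> A \<Longrightarrow> prime p \<and> 2 < p" "finite A" "dval_period A dvd m" "[h = l] (mod m)"
  shows "dval_dvd A k h \<longleftrightarrow> dval_dvd A k l"
proof -
  have "even h \<longleftrightarrow> even l"
  proof -
    have "2 dvd m" using assms(3) dvd_trans[of 2 "dval_period A" m] by (simp add: dval_period_def)
    then have "[h = l] (mod 2)" by (rule cong_dvd_modulus_nat[OF assms(4)])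
    then show ?thesis by (simp add: cong_def even_iff_mod_2_eq_zero)
  qed
  moreover have "int p dvd dval k h \<longleftrightarrow> int p dvd dval k l" if "p \<in> A" for p
  proof -
    have "p * (p - 1) dvd dval_period A"
      unfolding dval_period_def using that assms(2) by (intro dvd_mult dvd_prodI) auto
    then have "p * (p - 1) dvd m" using assms(3) dvd_trans by blast
    then have "p dvd m" "p - 1 dvd m" using dvd_mult_left dvd_mult_right by blast+
    then have hl: "[h = l] (mod p)" "[h = l] (mod (p - 1))"
      using assms(4) cong_dvd_modulus_nat by blast+
    have "[int h = int l] (mod int p)" using hl(1) by (simp add: cong_int_iff)
    moreover have "[dval k h + int h = dval k l + int l] (mod int p)"
      using that assms(1) hl(2) by (intro dval_cong) auto
    ultimately have "[dval k h + int h - int h = dval k l + int l - int l] (mod int p)"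
      by (intro cong_diff)
    then show ?thesis by (simp add: cong_dvd_iff)
  qed
  ultimately show ?thesis by (simp add: dval_dvd_def)
qed

lemma card_periodic:
  fixes m c :: nat
  assumes "\<And>h. Q (h + m) \<longleftrightarrow> Q h"
  shows "card {h. h < c * m \<and> Q h} = c * card {h. h < m \<and> Q h}"
proof (induction c)
  case (Suc c)
  have Q: "Q (h + i * m) \<longleftrightarrow> Q h" for h i
    by (induction i) (use assms[of "h + _ * m"] in \<open>simp_all add: ac_simps\<close>)
  have "{h. h < Suc c * m \<and> Q h} = {h. h < c * m \<and> Q h} \<union> (\<lambda>h. h + c * m) ` {h. h < m \<and> Q h}"
  proof (intro equalityI subsetI)
    fix h assume h: "h \<in> {h. h < Suc c * m \<and> Q h}"
    show "h \<in> {h. h < c * m \<and> Q h} \<union> (\<lambda>h. h + c * m) ` {h. h < m \<and> Q h}"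
    proof (cases "h < c * m")
      case False
      then have "h = (h - c * m) + c * m" by simp
      moreover have "h - c * m < m" using h False by auto
      moreover have "Q (h - c * m)" using h Q[of "h - c * m" c] False by simp
      ultimately show ?thesis by blast
    qed (use h in auto)
  qed (use Q in auto)
  moreover have "card ((\<lambda>h. h + c * m) ` {h. h < m \<and> Q h}) = card {h. h < m \<and> Q h}"
    by (intro card_image inj_onI) simp
  moreover have "{h. h < c * m \<and> Q h} \<inter> (\<lambda>h. h + c * m) ` {h. h < m \<and> Q h} = {}" by auto
  ultimately show ?case using Suc.IH by (simp add: card_Un_disjoint)
qed simp

text \<open>Adding the largest prime \<open>q\<close> last makes \<open>q\<close> coprime to the period \<open>m\<close> of all other data
  (including \<open>2 ^ h\<close> modulo \<open>q\<close>), so each admissible class modulo \<open>m\<close> lifts to exactly one class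
  modulo \<open>m q\<close>.\<close>

lemma card_dval_dvd_period:
  assumes "finite A" "\<And>p. p \<in> A \<Longrightarrow> prime p \<and> 2 < p"
  shows "card {h. h < dval_period A \<and> dval_dvd A k h} = (\<Prod>p\<in>A. p - 1)"
  using assms
proof (induction A rule: finite_linorder_max_induct)
  case empty
  have "{h::nat. h < 2 \<and> even h} = {0}" by (auto simp: less_2_cases_iff)
  then show ?case by (simp add: dval_period_def dval_dvd_def)
next
  case (insert q A)
  have A: "\<And>p. p \<in> A \<Longrightarrow> prime p \<and> 2 < p" and q: "prime q" "2 < q" and "q \<notin> A"
    using insert by auto
  define m where "m = (q - 1) * dval_period A"
  have per: "dval_period (insert q A) = m * q"
    using \<open>q \<notin> A\<close> insert.hyps(1) by (simp add: dval_period_def m_def)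
  have mpos: "m > 0" using q dval_period_pos[OF A] by (simp add: m_def)
  \<comment> \<open>All factors of \<open>m\<close> are positive and below q: 2, q - 1, and p and p
    - 1 for p in \<open>A\<close>.\<close>
  have below: "coprime q i" if "0 < i" "i < q" for i
    using that q(1) by (intro prime_imp_coprime) (auto dest: dvd_imp_le)
  have cop: "coprime m q"
  proof -
    have "coprime q (\<Prod>p\<in>A. p * (p - 1))"
    proof (rule prod_coprime_right)
      fix p assume "p \<in> A"
      then show "coprime q (p * (p - 1))"
        using A[of p] insert.hyps(2) by (intro coprime_mult_right_iff[THEN iffD2] conjI below) auto
    qed
    moreover have "coprime q 2" "coprime q (q - 1)" using q by (auto intro!: below simp del: coprime_right_2_iff_odd)
    ultimately have "coprime q m" unfolding m_def dval_period_def by simp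
    then show ?thesis by (simp add: coprime_commute)
  qed
  have q1: "q - 1 dvd m" and perm: "dval_period A dvd m" by (simp_all add: m_def)
  let ?B = "{h. h < m * q \<and> dval_dvd (insert q A) k h}" and ?R = "{h. h < m \<and> dval_dvd A k h}"
  have "bij_betw (\<lambda>h. h mod m) ?B ?R"
    unfolding bij_betw_def
  proof (intro conjI inj_onI equalityI subsetI)
    fix h l assume h: "h \<in> ?B" and l: "l \<in> ?B" and eq: "h mod m = l mod m"
    have hl: "[h = l] (mod m)" using eq by (simp add: cong_def)
    then have "[h = l] (mod (q - 1))" using q1 cong_dvd_modulus_nat by blast
    then have "[dval k h + int h = dval k l + int l] (mod int q)" by (intro dval_cong q)
    moreover have "[dval k h = 0] (mod int q)" "[dval k l = 0] (mod int q)"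
      using h l by (auto simp: dval_dvd_def cong_0_iff)
    ultimately have "[int h = int l] (mod int q)"
      by (metis add.left_neutral cong_add_rcancel cong_sym cong_trans)
    then have "[h = l] (mod q)" by (simp add: cong_int_iff)
    then have "[h = l] (mod (m * q))" using hl cop coprime_cong_mult_nat by blast
    then show "h = l" using h l by (simp add: cong_less_modulus_unique_nat)
  next
    fix h assume "h \<in> (\<lambda>h. h mod m) ` ?B"
    then obtain l where l: "h = l mod m" "dval_dvd (insert q A) k l" by blast
    have "dval_dvd A k l" using l by (simp add: dval_dvd_def)
    then have "dval_dvd A k h"
      using dval_dvd_cong[OF A insert.hyps(1) perm, of h l k] l by (simp add: cong_def)
    then show "h \<in> ?R" using l mpos by simp
  next
    fix h0 assume h0: "h0 \<in> ?R"
    \<comment> \<open>Divisibility by q demands h \<equiv> \<open>2 ^ k * (2 ^ h - 1)\<close> modulo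
      q. As q - 1 divides \<open>m\<close>, the right side is already fixed by \<open>h0\<close>, so
      the remainder theorem applies.\<close>
    obtain h where h: "h < m * q" "[h = h0] (mod m)" "[h = 2 ^ k * (2 ^ h0 - 1)] (mod q)"
      using binary_chinese_remainder_unique_nat[OF cop, of h0 "2 ^ k * (2 ^ h0 - 1)"] mpos q by auto
    have "dval_dvd A k h"
      using dval_dvd_cong[OF A insert.hyps(1) perm h(2), of k] h0 by simp
    moreover have "int q dvd dval k h"
    proof -
      have "[h = h0] (mod (q - 1))" using h(2) q1 cong_dvd_modulus_nat by blast
      then have "[dval k h + int h = dval k h0 + int h0] (mod int q)" by (intro dval_cong q)
      moreover have "dval k h0 + int h0 = int (2 ^ k * (2 ^ h0 - 1))"
        by (simp add: dval_def of_nat_diff)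
      moreover have "[int h = int (2 ^ k * (2 ^ h0 - 1))] (mod int q)"
        using h(3) by (simp only: cong_int_iff)
      ultimately have "[dval k h + int h - int h =
          int (2 ^ k * (2 ^ h0 - 1)) - int (2 ^ k * (2 ^ h0 - 1))] (mod int q)"
        by (intro cong_diff) auto
      then show ?thesis by (simp add: cong_0_iff)
    qed
    ultimately have "h \<in> ?B" using h(1) by (simp add: dval_dvd_def)
    moreover have "h0 = h mod m" using h(2) h0 by (simp add: cong_def)
    ultimately show "h0 \<in> (\<lambda>h. h mod m) ` ?B" by blast
  qed
  then have "card ?B = card ?R" by (rule bij_betw_same_card)
  \<comment> \<open>The range below \<open>m\<close> consists of q - 1 full periods for
    \<open>A\<close>.\<close>
  also have "\<dots> = (q - 1) * card {h. h < dval_period A \<and> dval_dvd A k h}"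
    unfolding m_def
  proof (rule card_periodic)
    show "dval_dvd A k (h + dval_period A) \<longleftrightarrow> dval_dvd A k h" for h
      by (rule dval_dvd_cong[OF A insert.hyps(1) dvd_refl]) (simp_all add: cong_def)
  qed
  also have "\<dots> = (\<Prod>p\<in>insert q A. p - 1)"
    using insert.IH A \<open>q \<notin> A\<close> insert.hyps(1) by simp
  finally show ?case by (simp only: per)
qed

text \<open>A full period has density 1 / (2 \<open>\<Prod>A\<close>), the factors p - 1 cancelling.
  The incomplete last period costs at most one period's count, and starting at 1 costs 1.\<close>

lemma card_dval_dvd_ge:
  assumes "finite A" "\<And>p. p \<in> A \<Longrightarrow> prime p \<and> 2 < p"
  shows "real L / (2 * real (\<Prod>A)) - (real (\<Prod>p\<in>A. p - 1) + 1) \<le> real (card {h \<in> {1..L}. dval_dvd A k h})"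
proof -
  define m where "m = dval_period A"
  define \<phi> where "\<phi> = (\<Prod>p\<in>A. p - 1)"
  define c where "c = L div m"
  have m: "real m = 2 * real (\<Prod>A) * real \<phi>"
    by (simp add: m_def \<phi>_def dval_period_def prod.distrib)
  have "\<phi> > 0" unfolding \<phi>_def using assms(2) by (intro prod_pos) force
  have "real (\<Prod>A) > 0" unfolding of_nat_prod using assms(2) by (intro prod_pos) force
  have "m > 0" unfolding m_def by (rule dval_period_pos[OF assms(2)])
  have "c * \<phi> = c * card {h. h < m \<and> dval_dvd A k h}"
    unfolding m_def \<phi>_def using assms by (simp add: card_dval_dvd_period)
  also have "\<dots> = card {h. h < c * m \<and> dval_dvd A k h}"
    unfolding m_def
  proof (rule card_periodic[symmetric])
    show "dval_dvd A k (h + dval_period A) \<longleftrightarrow> dval_dvd A k h" for h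
      by (rule dval_dvd_cong[OF assms(2) assms(1) dvd_refl]) (simp_all add: cong_def)
  qed
  \<comment> \<open>Periods start at 0, where d = 0 is divisible by everything, whereas h starts at
    1.\<close>
  also have "\<dots> \<le> card (insert 0 {h \<in> {1..L}. dval_dvd A k h})"
  proof (rule card_mono)
    have "c * m \<le> L" by (simp add: c_def)
    then show "{h. h < c * m \<and> dval_dvd A k h} \<subseteq> insert 0 {h \<in> {1..L}. dval_dvd A k h}"
      by auto
  qed simp
  also have "\<dots> \<le> card {h \<in> {1..L}. dval_dvd A k h} + 1"
    using card_insert_le_m1[of _ "{h \<in> {1..L}. dval_dvd A k h}"] by (simp add: card_insert_if)
  finally have cnt: "real c * real \<phi> \<le> real (card {h \<in> {1..L}. dval_dvd A k h}) + 1"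
    by (simp flip: of_nat_mult of_nat_Suc)
  have "L < (c + 1) * m" unfolding c_def using \<open>m > 0\<close> by (simp add: dividend_less_div_times)
  then have "real L \<le> (real c + 1) * real m"
    by (metis less_imp_le of_nat_1 of_nat_add of_nat_mono of_nat_mult)
  also have "\<dots> = ((real c + 1) * real \<phi>) * (2 * real (\<Prod>A))" by (simp add: m)
  finally have "real L / (2 * real (\<Prod>A)) \<le> (real c + 1) * real \<phi>"
    using \<open>real (\<Prod>A) > 0\<close> by (subst pos_divide_le_eq) simp_all
  then show ?thesis
    unfolding \<phi>_def[symmetric] using cnt distrib_right[of "real c" 1 "real \<phi>"] by linarith
qed

section \<open>Lower bound for the mean over the triangle k + h \<le> K\<close>

lemma sum_even_triangle_swap:
  "(\<Sum>h\<in>{h \<in> {1..K - 1}. even h}. \<Sum>k\<in>{1..K - h}. F k h) =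
   (\<Sum>k\<in>{1..K - 1}. \<Sum>h\<in>{h \<in> {1..K - k}. even (h::nat)}. F k h)"
proof -
  have "(\<Sum>h\<in>{h \<in> {1..K - 1}. even h}. \<Sum>k\<in>{1..K - h}. F k h) =
    (\<Sum>(h, k)\<in>Sigma {h \<in> {1..K - 1}. even h} (\<lambda>h. {1..K - h}). F k h)"
    by (rule sum.Sigma) auto
  also have "\<dots> = (\<Sum>(k, h)\<in>Sigma {1..K - 1} (\<lambda>k. {h \<in> {1..K - k}. even (h::nat)}). F k h)"
    by (rule sum.reindex_bij_witness[of _ prod.swap prod.swap]) auto
  also have "\<dots> = (\<Sum>k\<in>{1..K - 1}. \<Sum>h\<in>{h \<in> {1..K - k}. even (h::nat)}. F k h)"
    by (rule sum.Sigma[symmetric]) auto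
  finally show ?thesis .
qed

lemma singular_series_ge:
  assumes "d > 0"
  shows "2 * twin_prime_const * (\<Prod>p\<in>{p \<in> odd_primes_upto y. int p dvd d}. 1 + weight p) \<le> singular_series d"
proof -
  have "(\<Prod>p\<in>{p \<in> odd_primes_upto y. int p dvd d}. 1 + weight p) \<le>
    (\<Prod>p\<in>{p. prime p \<and> 2 < p \<and> int p dvd d}. 1 + weight p)"
    using assms by (intro prod_mono2 finite_prime_divisors) (auto simp: odd_primes_upto_def weight_def)
  then show ?thesis
    using assms twin_prime_const_nonneg by (simp add: singular_series_eq mult_left_mono)
qed

text \<open>\<open>D\<close> collects the losses of all sets \<open>A\<close> of primes up to
  \<open>y\<close>. It depends on \<open>y\<close> only, not on K, so its contribution is O(1 /
  K).\<close>

lemma singular_mean_ge: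
  obtains D :: real where "\<And>K. K \<ge> 1 \<Longrightarrow>
    2 * twin_prime_const * ((\<Prod>p\<in>odd_primes_upto y. 1 + weight p / real p) * ((real K - 1) / (4 * real K))
      - D * (real K - 1) / (real K)\<^sup>2) \<le> singular_mean K"
proof
  let ?P = "odd_primes_upto y" and ?C = "twin_prime_const"
  let ?V = "\<Prod>p\<in>?P. 1 + weight p / real p"
  define D where "D = (\<Sum>A\<in>Pow ?P. prod weight A * (real (\<Prod>p\<in>A. p - 1) + 1))"
  fix K :: nat assume K: "K \<ge> 1"
  have A: "finite A" "\<And>p. p \<in> A \<Longrightarrow> prime p \<and> 2 < p" "0 \<le> prod weight A" if "A \<in> Pow ?P" for A
  proof -
    show *: "finite A" "\<And>p. p \<in> A \<Longrightarrow> prime p \<and> 2 < p"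
      using that finite_subset[of A ?P] by (auto simp: odd_primes_upto_def)
    then show "0 \<le> prod weight A" by (intro prod_nonneg) (auto simp: weight_nonneg)
  qed
  have V: "?V = (\<Sum>A\<in>Pow ?P. prod weight A / real (\<Prod>A))"
    by (simp add: prod_one_plus_eq_sum_Pow prod_dividef)
  have inner: "real L * ?V / 2 - D \<le>
    (\<Sum>h\<in>{h \<in> {1..L}. even h}. \<Prod>p\<in>{p \<in> ?P. int p dvd dval k h}. 1 + weight p)" for k L
  proof -
    have "real L * ?V / 2 - D =
      (\<Sum>A\<in>Pow ?P. prod weight A * (real L / (2 * real (\<Prod>A)) - (real (\<Prod>p\<in>A. p - 1) + 1)))"
      unfolding V D_def right_diff_distrib sum_subtractf
      by (simp add: sum_distrib_left sum_divide_distrib mult_ac)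
    also have "\<dots> \<le> (\<Sum>A\<in>Pow ?P. prod weight A * real (card {h \<in> {1..L}. dval_dvd A k h}))"
      by (intro sum_mono mult_left_mono card_dval_dvd_ge A)
    also have "\<dots> = (\<Sum>A\<in>Pow ?P. prod weight A *
        (\<Sum>h\<in>{h \<in> {h \<in> {1..L}. even h}. \<forall>p\<in>A. int p dvd dval k h}. 1))"
      by (simp add: dval_dvd_def conj_assoc)
    also have "\<dots> = (\<Sum>h\<in>{h \<in> {1..L}. even h}. 1 * (\<Prod>p\<in>{p \<in> ?P. int p dvd dval k h}. 1 + weight p))"
      by (rule sum_mult_prod_one_plus_filter[symmetric]) auto
    finally show ?thesis by simp
  qed
  have tri: "(\<Sum>k\<in>{1..n}. real (n + 1 - k)) = real n * (real n + 1) / 2" for n :: nat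
  proof -
    have "(\<Sum>k\<in>{1..n}. real (n + 1 - k)) = (\<Sum>k\<in>{1..n}. real k)"
      by (rule sum.reindex_bij_witness[of _ "\<lambda>k. n + 1 - k" "\<lambda>k. n + 1 - k"]) auto
    also have "\<dots> = real n * (real n + 1) / 2" by (induction n) (auto simp: field_simps)
    finally show ?thesis .
  qed
  \<comment> \<open>The lengths K - k sum to K (K - 1) / 2, and the other factor 1/2 is the density
    of even h.\<close>
  have "2 * ?C * (?V / 2 * (real (K - 1) * real K / 2) - real (K - 1) * D) =
    2 * ?C * (\<Sum>k\<in>{1..K - 1}. real (K - k) * ?V / 2 - D)"
    using tri[of "K - 1"] K
    by (simp add: sum_subtractf of_nat_diff flip: sum_divide_distrib sum_distrib_right)
  also have "\<dots> \<le> 2 * ?C * (\<Sum>k\<in>{1..K - 1}. \<Sum>h\<in>{h \<in> {1..K - k}. even h}.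
      \<Prod>p\<in>{p \<in> ?P. int p dvd dval k h}. 1 + weight p)"
    using twin_prime_const_nonneg by (intro mult_left_mono sum_mono inner) auto
  also have "\<dots> = (\<Sum>k\<in>{1..K - 1}. \<Sum>h\<in>{h \<in> {1..K - k}. even h}.
      2 * ?C * (\<Prod>p\<in>{p \<in> ?P. int p dvd dval k h}. 1 + weight p))"
    by (simp add: sum_distrib_left)
  also have "\<dots> \<le> (\<Sum>k\<in>{1..K - 1}. \<Sum>h\<in>{h \<in> {1..K - k}. even h}. singular_series (dval k h))"
    by (intro sum_mono singular_series_ge dval_bounds) auto
  also have "\<dots> = (\<Sum>h\<in>{h \<in> {1..K - 1}. even h}. \<Sum>k\<in>{1..K - h}. singular_series (dval k h))"
    by (rule sum_even_triangle_swap[symmetric])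
  finally have "1 / (real K)\<^sup>2 * (2 * ?C * (?V / 2 * (real (K - 1) * real K / 2) - real (K - 1) * D)) \<le> singular_mean K"
    unfolding singular_mean_def by (intro mult_left_mono) auto
  moreover have "1 / (real K)\<^sup>2 * (2 * ?C * (?V / 2 * (real (K - 1) * real K / 2) - real (K - 1) * D)) =
    2 * ?C * (?V * ((real K - 1) / (4 * real K)) - D * (real K - 1) / (real K)\<^sup>2)"
    using K by (simp add: of_nat_diff field_simps power2_eq_square)
  ultimately show "2 * ?C * (?V * ((real K - 1) / (4 * real K)) - D * (real K - 1) / (real K)\<^sup>2) \<le> singular_mean K"
    by simp
qed

section \<open>Passage to the limit in N\<close>

lemma filterlim_Kfun: "filterlim Kfun at_top at_top"
  unfolding filterlim_at_top
proof
  fix Z :: nat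
  have "filterlim (\<lambda>N::nat. log 2 (real N) - 2 * log 2 (ln (real N))) at_top at_top"
    by real_asymp
  then have "eventually (\<lambda>N. real Z \<le> log 2 (real N) - 2 * log 2 (ln (real N))) at_top"
    by (simp add: filterlim_at_top)
  then show "eventually (\<lambda>N. Z \<le> Kfun N) at_top"
    by eventually_elim (simp add: Kfun_def le_nat_floor)
qed

lemma Phi_eq: "Phi N = singular_mean (Kfun N)"
  by (simp add: Phi_def singular_mean_def)

lemma liminf_Phi_ge: "ereal (1 / 2) \<le> liminf (\<lambda>N. ereal (Phi N))"
proof -
  define V where "V y = twin_prime_const * (\<Prod>p\<in>odd_primes_upto y. 1 + weight p / real p)" for y
  have V_le: "ereal (V y / 2) \<le> liminf (\<lambda>N. ereal (Phi N))" for y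
  proof -
    obtain D where D: "\<And>K. K \<ge> 1 \<Longrightarrow>
      2 * twin_prime_const * ((\<Prod>p\<in>odd_primes_upto y. 1 + weight p / real p) * ((real K - 1) / (4 * real K))
      - D * (real K - 1) / (real K)\<^sup>2) \<le> singular_mean K"
      using singular_mean_ge[of y] by metis
    let ?l = "\<lambda>K::nat. 2 * V y * ((real K - 1) / (4 * real K)) -
      2 * twin_prime_const * D * ((real K - 1) / (real K)\<^sup>2)"
    have l: "?l K \<le> singular_mean K" if "K \<ge> 1" for K
      using D[OF that] by (simp add: V_def algebra_simps)
    have "(\<lambda>K::nat. (real K - 1) / (4 * real K)) \<longlonglongrightarrow> 1 / 4" by real_asymp
    moreover have "(\<lambda>K::nat. (real K - 1) / (real K)\<^sup>2) \<longlonglongrightarrow> 0" by real_asymp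
    ultimately have "?l \<longlonglongrightarrow> 2 * V y * (1 / 4) - 2 * twin_prime_const * D * 0"
      by (intro tendsto_diff tendsto_mult tendsto_const)
    then have "(\<lambda>N. ?l (Kfun N)) \<longlonglongrightarrow> 2 * V y * (1 / 4) - 2 * twin_prime_const * D * 0"
      using filterlim_Kfun by (rule filterlim_compose)
    then have "(\<lambda>N. ereal (?l (Kfun N))) \<longlonglongrightarrow> ereal (V y / 2)" by simp
    then have "ereal (V y / 2) = liminf (\<lambda>N. ereal (?l (Kfun N)))"
      by (intro lim_imp_Liminf[symmetric]) auto
    also have "\<dots> \<le> liminf (\<lambda>N. ereal (Phi N))"
    proof (rule Liminf_mono)
      have "eventually (\<lambda>N. Kfun N \<ge> 1) sequentially"
        using filterlim_Kfun by (simp add: filterlim_at_top)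
      then show "eventually (\<lambda>N. ereal (?l (Kfun N)) \<le> ereal (Phi N)) sequentially"
        by eventually_elim (use l in \<open>simp add: Phi_eq\<close>)
    qed
    finally show ?thesis .
  qed
  \<comment> \<open>Only now does \<open>y\<close> grow: the right side of \<open>V_le\<close> is
    free of it.\<close>
  have "(\<lambda>y. ereal (V y / 2)) \<longlonglongrightarrow> ereal (1 / 2)"
    unfolding V_def by (intro tendsto_intros twin_prime_const_mult_limit) simp
  then show ?thesis by (rule LIMSEQ_le_const2) (blast intro: V_le)
qed

lemma limsup_Phi_le: "limsup (\<lambda>N. ereal (Phi N)) \<le> ereal (C_Rom / 2)"
proof -
  let ?X = "\<lambda>K::nat. exp (real K / log 2 (real K) / (real K - 1))"
  let ?u = "\<lambda>K::nat. ?X K * (C_Rom / 2 + 10 * (real K powr (1 / 3) / real K))"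
  have u: "singular_mean K \<le> ?u K" if "K \<ge> 2" for K
  proof -
    let ?W = "\<Prod>p\<in>odd_primes_upto K. 1 + weight p"
    have "?W ^ 3 \<le> 90 * real K" using that by (intro prod_upto_cube_bound) simp
    \<comment> \<open>Rounding 90 up to 125 gives an exact cube; the error 2 W / K is then O(K powr
      (-2/3)).\<close>
    also have "\<dots> \<le> 125 * real K" by simp
    also have "\<dots> = (5 * real K powr (1 / 3)) ^ 3"
      using that by (simp add: power_mult_distrib powr_power)
    finally have "?W \<le> 5 * real K powr (1 / 3)"
      by (rule power_le_imp_le_base[of _ 2, simplified]) simp
    then have "2 * ?W / real K \<le> 10 * (real K powr (1 / 3) / real K)"
      by (simp add: divide_right_mono)
    then have "?X K * (C_Rom / 2 + 2 * ?W / real K) \<le> ?u K"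
      by (intro mult_left_mono add_left_mono) auto
    with singular_mean_le[OF that] show ?thesis by linarith
  qed
  have "?X \<longlonglongrightarrow> 1" by real_asymp
  moreover have "(\<lambda>K::nat. real K powr (1 / 3) / real K) \<longlonglongrightarrow> 0" by real_asymp
  ultimately have "?u \<longlonglongrightarrow> 1 * (C_Rom / 2 + 10 * 0)" by (intro tendsto_intros)
  then have "(\<lambda>N. ?u (Kfun N)) \<longlonglongrightarrow> 1 * (C_Rom / 2 + 10 * 0)"
    using filterlim_Kfun by (rule filterlim_compose)
  then have "(\<lambda>N. ereal (?u (Kfun N))) \<longlonglongrightarrow> ereal (C_Rom / 2)" by simp
  then have "limsup (\<lambda>N. ereal (?u (Kfun N))) = ereal (C_Rom / 2)"
    by (intro lim_imp_Limsup) auto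
  moreover have "limsup (\<lambda>N. ereal (Phi N)) \<le> limsup (\<lambda>N. ereal (?u (Kfun N)))"
  proof (rule Limsup_mono)
    have "eventually (\<lambda>N. Kfun N \<ge> 2) sequentially"
      using filterlim_Kfun by (simp add: filterlim_at_top)
    then show "eventually (\<lambda>N. ereal (Phi N) \<le> ereal (?u (Kfun N))) sequentially"
      by eventually_elim (use u in \<open>simp add: Phi_eq\<close>)
  qed
  ultimately show ?thesis by simp
qed

theorem theorem1:
  "ereal (1 / 2) \<le> liminf (\<lambda>N. ereal (Phi N)) \<and>
   liminf (\<lambda>N. ereal (Phi N)) \<le> limsup (\<lambda>N. ereal (Phi N)) \<and>
   limsup (\<lambda>N. ereal (Phi N)) \<le> ereal (1 / 2 * (C_Rom + exp euler_mascheroni * ln 2))"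
proof (intro conjI)
  \<comment> \<open>The two sides differ by half of exp \<open>\<gamma>\<close> times log 2, which
    is nonnegative.\<close>
  have "ereal (C_Rom / 2) \<le> ereal (1 / 2 * (C_Rom + exp euler_mascheroni * ln 2))"
    by simp
  with limsup_Phi_le show "limsup (\<lambda>N. ereal (Phi N)) \<le> \<dots>" by (rule order_trans)
  show "liminf (\<lambda>N. ereal (Phi N)) \<le> limsup (\<lambda>N. ereal (Phi N))"
    by (rule Liminf_le_Limsup) simp
qed (rule liminf_Phi_ge)

end
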